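(* Let $n,k,s$ be positive integers, where $s$ is even and $n\ge (s+2)k-2$. Let $c$ be a proper coloring of $\operatorname{KG}_s(n,k)$ with colors $\{1,2,\dots,n-s(k-1)\}$ and let $A$ and $B$ form a partition of $\{1,2,\dots,n-s(k-1)\}$, with $l=|A|$ and $m=|B|$. Then there exists a complete bipartite subgraph $K_{l,m}$ of $\operatorname{KG}_s(n,k)$ with parts $L$ and $M$, $|L|=l$, $|M|=m$, such that the vertices of $L$ receive pairwise different colors from $A$ and the vertices of $M$ receive pairwise different colors from $B$ (so every color of $A$ appears on $L$ and every color of $B$ appears on $M$).
   Context: $[n]=\{1,\dots,n\}$. A nonempty subset $\mathcal{S}\subseteq[n]$ is $s$-stable if for any two different $i,j\in\mathcal{S}$, $s\le|i-j|\le n-s$. $\operatorname{KG}_s(n,k)$ has as vertices all $s$-stable $k$-subsets of $[n]$, two vertices adjacent iff disjoint. *)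

theory Defs
  imports "Graph_Theory.Graph_Theory"
begin

text \<open>Undirected graphs are symmetric digraphs, as in the Graph_Theory library. The distance
  condition is stated over the integers, so that neither difference is truncated.\<close>

definition s_stable :: "nat \<Rightarrow> nat \<Rightarrow> nat set \<Rightarrow> bool" where
  "s_stable s n S \<longleftrightarrow> S \<noteq> {} \<and> S \<subseteq> {1..n} \<and>
     (\<forall>i\<in>S. \<forall>j\<in>S. i \<noteq> j \<longrightarrow>
        int s \<le> \<bar>int i - int j\<bar> \<and> \<bar>int i - int j\<bar> \<le> int n - int s)"

definition stable_kneser_graph :: "nat \<Rightarrow> nat \<Rightarrow> nat \<Rightarrow> nat set pair_pre_digraph" where
  "stable_kneser_graph s n k =
     \<lparr>pverts = {S. s_stable s n S \<and> card S = k},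
      parcs = {(S, T). s_stable s n S \<and> card S = k \<and> s_stable s n T \<and> card T = k \<and> S \<inter> T = {}}\<rparr>"

definition proper_coloring :: "('a, 'b) pre_digraph \<Rightarrow> 'c set \<Rightarrow> ('a \<Rightarrow> 'c) \<Rightarrow> bool" where
  "proper_coloring G C c \<longleftrightarrow>
     c ` verts G \<subseteq> C \<and> (\<forall>(u, v) \<in> arcs_ends G. c u \<noteq> c v)"

text \<open>The library predicate for complete bipartite graphs hides the two parts behind an
  existential quantifier; here they are explicit.\<close>

definition complete_bipartite_graph :: "'a set \<Rightarrow> 'a set \<Rightarrow> 'a pair_pre_digraph" where
  "complete_bipartite_graph L M = \<lparr>pverts = L \<union> M, parcs = L \<times> M \<union> M \<times> L\<rparr>"

lemma complete_bipartite_digraph_complete_bipartite_graph: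
  assumes "finite L" "finite M" "L \<inter> M = {}"
  shows "complete_bipartite_digraph (card L) (card M) (with_proj (complete_bipartite_graph L M))"
  using assms unfolding complete_bipartite_digraph_pair_def complete_bipartite_graph_def by auto

lemma pair_graph_stable_kneser_graph: "pair_graph (stable_kneser_graph s n k)"
proof -
  let ?G = "stable_kneser_graph s n k"
  have nonempty: "S \<noteq> {}" and subset: "S \<subseteq> {1..n}" if "s_stable s n S" for S
    using that unfolding s_stable_def by blast+
  have "pverts ?G \<subseteq> Pow {1..n}"
    using subset unfolding stable_kneser_graph_def by auto
  then have fin_verts: "finite (pverts ?G)"
    by (rule finite_subset) simp
  have arcs: "parcs ?G \<subseteq> pverts ?G \<times> pverts ?G"
    by (auto simp: stable_kneser_graph_def)
  with fin_verts have fin_arcs: "finite (parcs ?G)"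
    by (meson finite_SigmaI finite_subset)
  have "sym (parcs ?G)"
    unfolding stable_kneser_graph_def sym_def by (simp add: Int_commute)
  then have sym: "symmetric (with_proj ?G)"
    unfolding symmetric_def by simp
  have no_loops: "fst e \<noteq> snd e" if e: "e \<in> parcs ?G" for e
  proof -
    obtain S T where "e = (S, T)" "s_stable s n S" "S \<inter> T = {}"
      using e by (auto simp: stable_kneser_graph_def)
    then show ?thesis
      using nonempty[of S] by auto
  qed
  have wf: "fst e \<in> pverts ?G" "snd e \<in> pverts ?G" if "e \<in> parcs ?G" for e
    using that arcs by (auto simp: mem_Times_iff)
  show ?thesis
    by unfold_locales (fact wf fin_verts fin_arcs no_loops sym | erule wf no_loops)+
qed

end

theory Submission
  imports Defs "HOL-Library.Z2"
begin

text \<open>Write \<open>s = 2h\<close>. Under the hypothesis on \<open>n\<close>, every 2-stable set with \<open>h(k-1)+1\<close> elements contains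
  an \<open>s\<close>-stable \<open>k\<close>-set (greedy selection), so a sign vector with an alternating subvector of length
  \<open>r = 2(h(k-1)+1)\<close> has \<open>s\<close>-stable \<open>k\<close>-sets among its positive and among its negative positions.
  These sign vectors form an antipodal sphere of dimension \<open>e = n - r\<close>, and there are \<open>e + 2\<close> colours.
  Let \<open>p\<close> and \<open>q\<close> be the largest colours on the positive and on the negative side. A parity argument in
  the style of Fan's lemma shows that an odd number of maximal chains has all colours but one as values
  of \<open>p\<close>. A prism argument between \<open>p\<close> and \<open>q\<close> shows that, modulo 2, the number of chains on whose
  initial part \<open>p\<close> takes exactly the colours \<open>A\<close> and on whose final part \<open>q\<close> takes exactly the colours
  \<open>B\<close> does not change when a colour moves from \<open>A\<close> to \<open>B\<close>. The top of such a chain carries the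
  complete bipartite graph.\<close>

section \<open>Sums modulo two\<close>

text \<open>The value of \<open>r\<close> comes from counting: with \<open>e = n - r\<close> there
  are \<open>n - s * (k - 1) = e + 2\<close> colours, while a maximal chain has only
  \<open>e + 1\<close> members. So one member must show two colours, one on each side; it is where a
  chain turns from \<open>p\<close> to \<open>q\<close>. Evenness of \<open>s\<close> makes
  \<open>r\<close> even, so the first and last entries of an alternating vector of length
  \<open>r\<close> have opposite signs, and equal signs are separated by an opposite one even across
  the end of the cycle. The obstacle is that \<open>A\<close> and \<open>B\<close> are prescribed: a
  Fan-type count alone yields one fixed pattern, with all colours but the least on the positive
  side. The numbering of the colours is free, however, so any colour of \<open>B\<close> can be made
  the least one, and the others are then moved across one by one. The moves rely on \<open>p\<close>
  and \<open>q\<close> never sharing a value along a chain. This is where properness enters, since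
  sets on opposite sides are disjoint.\<close>

lemma bit_add_self: "(x::bit) + x = 0"
  by (cases x) auto

lemma of_nat_bit_eq_0_iff: "(of_nat m :: bit) = 0 \<longleftrightarrow> even m"
  by (induction m) (auto simp: bit_add_self)

text \<open>Parity arguments are carried out as sums over the two-element field: two chains that differ
  in a single entry cancel each other.\<close>

lemma sum_fun_upd_cancel:
  fixes F :: "('i \<Rightarrow> 'a) \<Rightarrow> bit"
  assumes fin: "finite Z"
    and ev: "\<And>y. y \<in> Z \<Longrightarrow> even (card {v. y(j := v) \<in> Z})"
    and F: "\<And>y v. y \<in> Z \<Longrightarrow> y(j := v) \<in> Z \<Longrightarrow> F (y(j := v)) = F y"
  shows "(\<Sum>y\<in>Z. F y) = 0"
proof -
  define h :: "('i \<Rightarrow> 'a) \<Rightarrow> ('i \<Rightarrow> 'a)" where "h y = y(j := undefined)" for y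
  have "(\<Sum>y\<in>Z. F y) = (\<Sum>w\<in>h ` Z. \<Sum>y\<in>{y \<in> Z. h y = w}. F y)"
    using fin by (rule sum.image_gen)
  also have "\<dots> = (\<Sum>w\<in>h ` Z. 0)"
  proof (rule sum.cong[OF refl])
    fix w assume "w \<in> h ` Z"
    then obtain y where y: "y \<in> Z" "w = h y" by blast
    let ?V = "{v. y(j := v) \<in> Z}"
    have eq: "{x \<in> Z. h x = w} = (\<lambda>v. y(j := v)) ` ?V"
    proof (intro equalityI subsetI)
      fix x assume x: "x \<in> {x \<in> Z. h x = w}"
      have "x = y(j := x j)"
      proof
        fix i
        have "h x i = h y i" using x y(2) by simp
        then show "x i = (y(j := x j)) i" by (auto simp: h_def split: if_splits)
      qed
      then show "x \<in> (\<lambda>v. y(j := v)) ` ?V" using x by (metis (mono_tags, lifting) image_iff mem_Collect_eq)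
    qed (auto simp: y h_def)
    have inj: "inj_on (\<lambda>v. y(j := v)) ?V"
      by (rule inj_onI) (metis fun_upd_same)
    have "(\<Sum>x\<in>{x \<in> Z. h x = w}. F x) = (\<Sum>v\<in>?V. F (y(j := v)))"
      unfolding eq by (simp add: sum.reindex[OF inj])
    also have "\<dots> = (\<Sum>v\<in>?V. F y)"
      by (rule sum.cong) (auto intro: F y)
    also have "\<dots> = of_nat (card ?V) * F y" by simp
    also have "\<dots> = 0" using ev[OF y(1)] by (auto elim!: evenE)
    finally show "(\<Sum>x\<in>{x \<in> Z. h x = w}. F x) = 0" .
  qed
  finally show ?thesis by simp
qed

text \<open>The index map of a simplicial face: \<open>s \<circ> skip j\<close> is \<open>s\<close>
  with entry \<open>j\<close> deleted.\<close>

definition skip :: "nat \<Rightarrow> nat \<Rightarrow> nat" where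
  "skip j i = (if i < j then i else Suc i)"

definition alt_seq :: "bit \<Rightarrow> nat \<Rightarrow> (nat \<Rightarrow> bit) \<Rightarrow> bool" where
  "alt_seq b d s \<longleftrightarrow> (\<forall>i<d. s i = b + of_nat i)"

lemma alt_seq_Suc: "alt_seq b (Suc d) s \<longleftrightarrow> alt_seq b d s \<and> s d = b + of_nat d"
  by (auto simp: alt_seq_def less_Suc_eq)

text \<open>An alternating sequence stays alternating only when an end entry is deleted, and exactly
  one deletion leaves the start \<open>b\<close>. With a single repetition, deleting either of the
  two equal neighbours gives the same sequence, so these deletions cancel.\<close>

lemma sum_alt_seq_skip:
  "(\<Sum>j\<le>d. of_bool (alt_seq b d (s \<circ> skip j))) =
    (of_bool (alt_seq b (Suc d) s) + of_bool (alt_seq (b + 1) (Suc d) s) :: bit)"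
proof (induction d)
  case 0
  show ?case by (cases b; cases "s 0") (auto simp: alt_seq_def)
next
  case (Suc d)
  \<comment> \<open>Deleting the last entry leaves the initial segment; any earlier deletion keeps
    the last entry, so it only multiplies the induction hypothesis by a condition on that
    entry.\<close>
  have 1: "alt_seq b (Suc d) (s \<circ> skip (Suc d)) = alt_seq b (Suc d) s"
    by (auto simp: alt_seq_def skip_def)
  have 2: "(of_bool (alt_seq b (Suc d) (s \<circ> skip j)) :: bit) =
    of_bool (alt_seq b d (s \<circ> skip j)) * of_bool (s (Suc d) = b + of_nat d)" if "j \<le> d" for j
    using that by (auto simp: alt_seq_Suc skip_def)
  have "(\<Sum>j\<le>Suc d. of_bool (alt_seq b (Suc d) (s \<circ> skip j)) :: bit) =
    (of_bool (alt_seq b (Suc d) s) + of_bool (alt_seq (b + 1) (Suc d) s)) *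
      of_bool (s (Suc d) = b + of_nat d) + of_bool (alt_seq b (Suc d) s)"
    unfolding sum.atMost_Suc 1 Suc.IH[symmetric] sum_distrib_right
    by (rule arg_cong2[where f = "(+)", OF sum.cong[OF refl] refl], rule 2) simp
  also have "\<dots> = of_bool (alt_seq b (Suc (Suc d)) s) + of_bool (alt_seq (b + 1) (Suc (Suc d)) s)"
    unfolding alt_seq_Suc[of _ "Suc d"]
    by (cases "s (Suc d)"; cases "b"; cases "of_nat d :: bit") auto
  finally show ?case .
qed

section \<open>Signed sets and chains\<close>

text \<open>A sign vector of length \<open>n\<close> is encoded by a set of integers containing \<open>i\<close> for an entry \<open>+\<close> and
  \<open>-i\<close> for an entry \<open>-\<close> at position \<open>i\<close> (so that \<open>0\<close> is excluded); the componentwise order becomes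
  inclusion and the antipode becomes the image under negation.\<close>

definition signed :: "nat \<Rightarrow> int set set" where
  "signed n = {X. X \<subseteq> {- int n..int n} \<and> (\<forall>x\<in>X. - x \<notin> X)}"

text \<open>The cardinality is the rank of the entry among the nonzero positions, and
  \<open>b\<close> is the sign of the first nonzero entry.\<close>

definition alternating :: "bit \<Rightarrow> int set \<Rightarrow> bool" where
  "alternating b X \<longleftrightarrow> (\<forall>x\<in>X. of_bool (x < 0) = b + of_nat (card {y \<in> X. \<bar>y\<bar> < \<bar>x\<bar>}))"

text \<open>These are the facets of a triangulated sphere of dimension \<open>e\<close>. It consists of the sign vectors
  that have \<open>r\<close> alternating entries, hence room for stable sets on both signs.\<close>

definition sign_chains :: "nat \<Rightarrow> nat \<Rightarrow> (nat \<Rightarrow> int set) set" where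
  "sign_chains r e = {y. (\<exists>b. alternating b (y 0)) \<and>
     (\<forall>i\<le>e. y i \<in> signed (r + e) \<and> card (y i) = r + i) \<and>
     (\<forall>i<e. y i \<subseteq> y (Suc i)) \<and> (\<forall>i>e. y i = {})}"

lemma finite_signed: "finite (signed n)"
  unfolding signed_def by (rule finite_subset[of _ "Pow {- int n..int n}"]) auto

lemma signed_finite: "X \<in> signed n \<Longrightarrow> finite X"
  unfolding signed_def by (auto intro: finite_subset[of _ "{- int n..int n}"])

text \<open>The default value \<open>{}\<close> beyond index \<open>e\<close> makes a chain a
  function with finitely many free values.\<close>

lemma finite_chains: "finite (sign_chains r e)"
proof (rule finite_subset)
  show "sign_chains r e \<subseteq> {y. \<forall>i. (i \<in> {..e} \<longrightarrow> y i \<in> signed (r + e)) \<and> (i \<notin> {..e} \<longrightarrow> y i = {})}"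
    by (auto simp: sign_chains_def)
  show "finite {y. \<forall>i. (i \<in> {..e} \<longrightarrow> y i \<in> signed (r + e)) \<and> (i \<notin> {..e} \<longrightarrow> y i = {})}"
    by (rule finite_set_of_finite_funs) (auto simp: finite_signed)
qed

lemma signed_subset: "X \<in> signed n \<Longrightarrow> Y \<subseteq> X \<Longrightarrow> Y \<in> signed n"
  unfolding signed_def by blast

lemma signed_uminus: "X \<in> signed n \<Longrightarrow> uminus ` X \<in> signed n"
  unfolding signed_def by (auto simp: minus_le_iff le_minus_iff)

lemma signed_abs_inj:
  assumes "X \<in> signed n" shows "inj_on abs X"
proof (rule inj_onI)
  fix x y assume "x \<in> X" "y \<in> X" "\<bar>x\<bar> = \<bar>y\<bar>"
  moreover have "x = y \<or> x = - y" using \<open>\<bar>x\<bar> = \<bar>y\<bar>\<close> by linarith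
  ultimately show "x = y" using assms by (auto simp: signed_def)
qed

lemma signed_abs_range:
  assumes "X \<in> signed n" shows "abs ` X \<subseteq> {1..int n}"
proof
  fix z assume "z \<in> abs ` X"
  then obtain x where x: "x \<in> X" "z = \<bar>x\<bar>" by blast
  have "x \<noteq> 0" using assms x by (auto simp: signed_def)
  moreover have "- int n \<le> x" "x \<le> int n" using assms x by (auto simp: signed_def)
  ultimately show "z \<in> {1..int n}" using x by auto
qed

section \<open>Alternation along the order of positions\<close>

lemma signed_enum:
  assumes "X \<in> signed n"
  obtains f :: "nat \<Rightarrow> int" where "bij_betw f {..<card X} X"
    "\<And>i j. i < card X \<Longrightarrow> j < card X \<Longrightarrow> \<bar>f i\<bar> < \<bar>f j\<bar> \<longleftrightarrow> i < j"
proof -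
  have finX: "finite X" by (rule signed_finite[OF assms])
  let ?l = "sorted_list_of_set (abs ` X)"
  have len: "length ?l = card X"
    using card_image[OF signed_abs_inj[OF assms]] finX by simp
  have bl: "bij_betw ((!) ?l) {..<card X} (abs ` X)"
    using bij_betw_nth[of ?l "{..<card X}" "abs ` X"] len finX by simp
  have bi: "bij_betw (inv_into X abs) (abs ` X) X"
    by (rule bij_betw_inv_into) (simp add: bij_betw_def signed_abs_inj[OF assms])
  define f where "f = inv_into X abs \<circ> (!) ?l"
  have "bij_betw f {..<card X} X"
    unfolding f_def by (rule bij_betw_trans[OF bl bi])
  moreover have "\<bar>f i\<bar> = ?l ! i" if "i < card X" for i
    using that bl unfolding f_def by (simp add: bij_betw_def f_inv_into_f) (metis f_inv_into_f imageI lessThan_iff)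
  moreover have "?l ! i < ?l ! j \<longleftrightarrow> i < j" if "i < card X" "j < card X" for i j
    using that len strict_sorted_list_of_set[of "abs ` X"]
    by (metis linorder_neqE_nat order_less_asym sorted_wrt_nth_less less_irrefl)
  ultimately show ?thesis using that by simp
qed

lemma alternating_iff_alt_seq:
  assumes bij: "bij_betw f {..<m} X"
    and mono: "\<And>i j. i < m \<Longrightarrow> j < m \<Longrightarrow> \<bar>f i\<bar> < \<bar>f j\<bar> \<longleftrightarrow> i < (j::nat)"
  shows "alternating b X \<longleftrightarrow> alt_seq b m (\<lambda>i. of_bool (f i < 0))"
proof -
  have "card {y \<in> X. \<bar>y\<bar> < \<bar>f i\<bar>} = i" if "i < m" for i
  proof -
    have "X = f ` {..<m}" using bij by (simp add: bij_betw_def)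
    then have "{y \<in> X. \<bar>y\<bar> < \<bar>f i\<bar>} = f ` {j \<in> {..<m}. \<bar>f j\<bar> < \<bar>f i\<bar>}" by blast
    also have "{j \<in> {..<m}. \<bar>f j\<bar> < \<bar>f i\<bar>} = {..<i}" using mono that by auto
    finally have "{y \<in> X. \<bar>y\<bar> < \<bar>f i\<bar>} = f ` {..<i}" .
    moreover have "inj_on f {..<i}"
      by (rule inj_on_subset[OF bij_betw_imp_inj_on[OF bij]]) (use that in auto)
    ultimately show ?thesis by (simp add: card_image)
  qed
  then show ?thesis
    using bij unfolding alternating_def alt_seq_def bij_betw_def by fastforce
qed

text \<open>For both starting signs \<open>sum_alt_seq_skip\<close> gives the same value, so the two
  sums cancel. This governs the exchange of the smallest member of a chain.\<close>

lemma even_card_alternating_Diff: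
  assumes X: "X \<in> signed n" "card X = Suc r" and r: "r > 0"
  shows "even (card {x \<in> X. \<exists>b. alternating b (X - {x})})"
proof -
  obtain f where bij: "bij_betw f {..<card X} X"
    and mono: "\<And>i j. i < card X \<Longrightarrow> j < card X \<Longrightarrow> \<bar>f i\<bar> < \<bar>f j\<bar> \<longleftrightarrow> i < j"
    using signed_enum[OF X(1)] by metis
  define s where "s i = (of_bool (f i < 0) :: bit)" for i
  have alt: "alternating b (X - {f j}) \<longleftrightarrow> alt_seq b r (s \<circ> skip j)" if "j \<le> r" for b j
  proof -
    have "bij_betw (skip j) {..<r} ({..<Suc r} - {j})"
    proof (rule bij_betwI')
      fix y assume y: "y \<in> {..<Suc r} - {j}"
      show "\<exists>x\<in>{..<r}. y = skip j x"
        using y that by (intro bexI[of _ "if y < j then y else y - 1"]) (auto simp: skip_def)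
    qed (auto simp: skip_def split: if_splits)
    moreover have "bij_betw f ({..<Suc r} - {j}) (X - {f j})"
      using bij X(2) that by (auto simp: bij_betw_def inj_on_def)
    ultimately have b: "bij_betw (f \<circ> skip j) {..<r} (X - {f j})"
      by (rule bij_betw_trans)
    have "alternating b (X - {f j}) \<longleftrightarrow> alt_seq b r (\<lambda>i. of_bool ((f \<circ> skip j) i < 0))"
      by (rule alternating_iff_alt_seq[OF b]) (use mono X(2) in \<open>auto simp: skip_def\<close>)
    then show ?thesis by (simp add: s_def comp_def)
  qed
  \<comment> \<open>As \<open>r > 0\<close>, a subvector determines its starting sign, so the two
    cases exclude each other and the disjunction becomes a sum.\<close>
  have excl: "(of_bool (\<exists>b. alternating b (X - {f j})) :: bit) =
     of_bool (alt_seq 0 r (s \<circ> skip j)) + of_bool (alt_seq 1 r (s \<circ> skip j))" if "j \<le> r" for j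
  proof -
    have "\<not> (alt_seq 0 r (s \<circ> skip j) \<and> alt_seq 1 r (s \<circ> skip j))"
      using r unfolding alt_seq_def by (metis add.right_neutral of_nat_0 zero_neq_one)
    moreover have "(\<exists>b. alternating b (X - {f j})) \<longleftrightarrow>
        alt_seq 0 r (s \<circ> skip j) \<or> alt_seq 1 r (s \<circ> skip j)"
      unfolding alt[OF that] by (metis bit.exhaust)
    ultimately show ?thesis by auto
  qed
  have "of_nat (card {x \<in> X. \<exists>b. alternating b (X - {x})}) =
      (\<Sum>x\<in>X. of_bool (\<exists>b. alternating b (X - {x})) :: bit)"
    using signed_finite[OF X(1)] by (simp add: of_bool_def sum.If_cases Int_def)
  also have "\<dots> = (\<Sum>j\<le>r. of_bool (\<exists>b. alternating b (X - {f j})))"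
    using sum.reindex_bij_betw[OF bij, of "\<lambda>x. of_bool (\<exists>b. alternating b (X - {x})) :: bit"]
    by (simp add: X(2) lessThan_Suc_atMost)
  also have "\<dots> = (\<Sum>j\<le>r. of_bool (alt_seq 0 r (s \<circ> skip j))) + (\<Sum>j\<le>r. of_bool (alt_seq 1 r (s \<circ> skip j)))"
    unfolding sum.distrib[symmetric] by (rule sum.cong[OF refl], rule excl) simp
  also have "\<dots> = 0"
    unfolding sum_alt_seq_skip
    by (cases "alt_seq 0 (Suc r) s"; cases "alt_seq 1 (Suc r) s") simp_all
  finally show ?thesis by (simp only: of_nat_bit_eq_0_iff)
qed

text \<open>Every member of a chain lies here, so labels need to be controlled only on this set. For
  even \<open>r\<close> such a vector has at least \<open>r / 2\<close> entries of each
  sign.\<close>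

definition two_sided :: "nat \<Rightarrow> nat \<Rightarrow> int set set" where
  "two_sided r n = {X \<in> signed n. \<exists>b. \<exists>v\<subseteq>X. alternating b v \<and> card v = r}"

lemma sign_chainsD:
  assumes "y \<in> sign_chains r e"
  shows "\<exists>b. alternating b (y 0)" "i \<le> e \<Longrightarrow> y i \<in> signed (r + e)" "i \<le> e \<Longrightarrow> card (y i) = r + i"
    "i < e \<Longrightarrow> y i \<subseteq> y (Suc i)" "i > e \<Longrightarrow> y i = {}"
  using assms unfolding sign_chains_def by auto

lemma sign_chains_mono:
  assumes "y \<in> sign_chains r e" "i \<le> j" "j \<le> e"
  shows "y i \<subseteq> y j"
  using assms(2,3)
proof (induction j rule: dec_induct)
  case (step j)
  then show ?case using sign_chainsD(4)[OF assms(1), of j] by auto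
qed auto

lemma sign_chains_two_sided:
  assumes "y \<in> sign_chains r e" "i \<le> e"
  shows "y i \<in> two_sided r (r + e)"
  unfolding two_sided_def
  using sign_chainsD(1,2)[OF assms(1)] sign_chainsD(3)[OF assms(1), of 0] sign_chains_mono[OF assms(1), of 0 i] assms(2) by auto

section \<open>Exchanging one member of a chain\<close>

lemma card_sets_between:
  assumes "W1 \<subseteq> W2" "finite W2" "card W2 = card W1 + 2"
  shows "card {v. W1 \<subseteq> v \<and> v \<subseteq> W2 \<and> card v = card W1 + 1} = 2"
proof -
  have fin1: "finite W1" using assms finite_subset by blast
  have "card (W2 - W1) = 2" using assms by (simp add: card_Diff_subset fin1)
  then obtain a b where ab: "W2 - W1 = {a, b}" "a \<noteq> b" by (auto simp: card_2_iff)
  have "{v. W1 \<subseteq> v \<and> v \<subseteq> W2 \<and> card v = card W1 + 1} = {insert a W1, insert b W1}" (is "?L = ?R")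
  proof (intro equalityI subsetI)
    fix v assume v: "v \<in> ?L"
    then have "finite v" using assms(2) finite_subset by blast
    then have "card (v - W1) = 1" using v fin1 by (simp add: card_Diff_subset)
    then obtain x where "v - W1 = {x}" by (auto simp: card_1_singleton_iff)
    moreover have "x \<in> {a, b}" using calculation v unfolding ab(1)[symmetric] by blast
    moreover have "v = insert x W1" using calculation(1) v by blast
    ultimately show "v \<in> ?R" by blast
  next
    fix v assume "v \<in> ?R"
    moreover have "a \<in> W2 - W1" "b \<in> W2 - W1" using ab by auto
    ultimately show "v \<in> ?L" using assms(1) fin1 by auto
  qed
  moreover have "insert a W1 \<noteq> insert b W1" using ab by (metis DiffE insertI1 insert_iff)
  ultimately show ?thesis by simp
qed

text \<open>Exactly one position is empty and it accepts either sign; this gives the largest member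
  of a chain two possible values.\<close>

lemma signed_extensions:
  assumes "W \<in> signed n" "card W = n - 1" "n > 0"
  obtains q where "0 < q" "q \<le> int n" "q \<notin> W" "- q \<notin> W"
    "{v \<in> signed n. W \<subseteq> v \<and> card v = n} = {insert q W, insert (- q) W}"
proof -
  have finW: "finite W" using signed_finite[OF assms(1)] .
  have "card (abs ` W) = n - 1" using card_image[OF signed_abs_inj[OF assms(1)]] assms(2) by simp
  moreover have "abs ` W \<subseteq> {1..int n}" by (rule signed_abs_range[OF assms(1)])
  ultimately have "card ({1..int n} - abs ` W) = 1"
    using assms(3) finW by (subst card_Diff_subset) auto
  then obtain q where q: "{1..int n} - abs ` W = {q}" by (auto simp: card_1_singleton_iff)
  then have "q \<in> {1..int n} - abs ` W" by blast
  then have q1: "0 < q" "q \<le> int n" "q \<notin> abs ` W" by auto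
  have qW: "q \<notin> W" "- q \<notin> W" using q1(1,3) by (force simp: image_iff)+
  have "{v \<in> signed n. W \<subseteq> v \<and> card v = n} = {insert q W, insert (- q) W}" (is "?L = ?R")
  proof (intro equalityI subsetI)
    fix v assume v: "v \<in> ?L"
    then have finv: "finite v" using signed_finite by blast
    then have "card (v - W) = 1" using v finW assms by (simp add: card_Diff_subset)
    then obtain x where x: "v - W = {x}" by (auto simp: card_1_singleton_iff)
    have vx: "v = insert x W" using x v by blast
    have "\<bar>x\<bar> \<in> {1..int n}" using signed_abs_range[of v n] v x by blast
    moreover have "\<bar>x\<bar> \<notin> abs ` W"
    proof
      assume "\<bar>x\<bar> \<in> abs ` W"
      then obtain w where "w \<in> W" "\<bar>x\<bar> = \<bar>w\<bar>" by blast
      moreover have "inj_on abs v" using v signed_abs_inj by blast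
      ultimately have "x = w" unfolding vx by - (rule inj_onD[of abs "insert x W"], auto)
      then show False using \<open>w \<in> W\<close> x by blast
    qed
    ultimately have "\<bar>x\<bar> = q" using q by blast
    then have "x = q \<or> x = - q" by linarith
    then show "v \<in> ?R" using vx by auto
  next
    fix v assume v: "v \<in> ?R"
    have "v \<in> signed n"
    proof -
      obtain x where x: "v = insert x W" "x \<in> {q, - q}" using v by (elim insertE emptyE) simp_all
      have "x \<in> {- int n..int n}" "x \<noteq> - x" "- x \<notin> W" using x(2) q1(1,2) qW by auto
      then show ?thesis using assms(1) unfolding signed_def x(1) by auto
    qed
    moreover have "card v = n" using v qW finW assms(2,3) by (elim insertE emptyE) simp_all
    moreover have "W \<subseteq> v" using v by (elim insertE emptyE) blast+
    ultimately show "v \<in> ?L" by simp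
  qed
  then show ?thesis using that q1 qW by blast
qed

lemma fun_upd_chains_iff:
  assumes y: "y \<in> sign_chains r e" and j: "j \<le> e"
  shows "y(j := v) \<in> sign_chains r e \<longleftrightarrow> (j = 0 \<longrightarrow> (\<exists>b. alternating b v)) \<and> v \<in> signed (r + e) \<and> card v = r + j
    \<and> (j > 0 \<longrightarrow> y (j - 1) \<subseteq> v) \<and> (j < e \<longrightarrow> v \<subseteq> y (Suc j))"
proof
  assume "y(j := v) \<in> sign_chains r e"
  note c = sign_chainsD[OF this]
  show "(j = 0 \<longrightarrow> (\<exists>b. alternating b v)) \<and> v \<in> signed (r + e) \<and> card v = r + j
    \<and> (j > 0 \<longrightarrow> y (j - 1) \<subseteq> v) \<and> (j < e \<longrightarrow> v \<subseteq> y (Suc j))"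
  proof (intro conjI impI)
    show "y (j - 1) \<subseteq> v" if "j > 0"
    proof -
      have "j - 1 < e" "Suc (j - 1) = j" "j - 1 \<noteq> j" using that j by auto
      then show ?thesis using c(4)[of "j - 1"] by simp
    qed
  qed (use c(1) c(2)[of j] c(3)[of j] c(4)[of j] j in auto)
next
  assume v: "(j = 0 \<longrightarrow> (\<exists>b. alternating b v)) \<and> v \<in> signed (r + e) \<and> card v = r + j
    \<and> (j > 0 \<longrightarrow> y (j - 1) \<subseteq> v) \<and> (j < e \<longrightarrow> v \<subseteq> y (Suc j))"
  have "(y(j := v)) i \<subseteq> (y(j := v)) (Suc i)" if "i < e" for i
  proof -
    consider "i = j" | "j = Suc i" | "i \<noteq> j" "Suc i \<noteq> j" by blast
    then show ?thesis using v sign_chainsD(4)[OF y that] that by cases simp_all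
  qed
  moreover have "\<exists>b. alternating b ((y(j := v)) 0)" using v sign_chainsD(1)[OF y] by simp
  moreover have "(y(j := v)) i \<in> signed (r + e) \<and> card ((y(j := v)) i) = r + i" if "i \<le> e" for i
    using v sign_chainsD(2,3)[OF y that] by simp
  moreover have "(y(j := v)) i = {}" if "i > e" for i
    using sign_chainsD(5)[OF y that] j that by simp
  ultimately show "y(j := v) \<in> sign_chains r e" unfolding sign_chains_def by blast
qed

text \<open>An exchange below the top concerns either the alternating base, through
  \<open>even_card_alternating_Diff\<close>, or one of the two sets strictly between the neighbours.
  The top is treated apart, because its exchange may leave a hemisphere.\<close>

lemma even_card_fun_upd_chains_less:
  assumes y: "y \<in> sign_chains r e" and j: "j < e" and r: "r > 0"
  shows "even (card {v. y(j := v) \<in> sign_chains r e})"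
proof (cases "j = 0")
  case True
  let ?X = "y 1"
  have X: "?X \<in> signed (r + e)" "card ?X = Suc r"
    using sign_chainsD(2,3)[OF y, of 1] j True by auto
  have finX: "finite ?X" using signed_finite X(1) .
  have "{v. y(j := v) \<in> sign_chains r e} = (\<lambda>x. ?X - {x}) ` {x \<in> ?X. \<exists>b. alternating b (?X - {x})}" (is "?L = ?R")
  proof (intro equalityI subsetI)
    fix v assume "v \<in> ?L"
    then have v: "\<exists>b. alternating b v" "card v = r" "v \<subseteq> ?X"
      using fun_upd_chains_iff[OF y, of j v] j True by auto
    then have "card (?X - v) = 1" using X finX by (simp add: card_Diff_subset finite_subset)
    then obtain x where "?X - v = {x}" by (auto simp: card_1_singleton_iff)
    then have "v = ?X - {x}" "x \<in> ?X" using v(3) by auto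
    then show "v \<in> ?R" using v(1) by auto
  next
    fix v assume "v \<in> ?R"
    then obtain x where x: "x \<in> ?X" "\<exists>b. alternating b (?X - {x})" "v = ?X - {x}" by blast
    then have "card v = r" using X finX by simp
    then show "v \<in> ?L"
      using fun_upd_chains_iff[OF y, of j v] j True x signed_subset[OF X(1), of v] by auto
  qed
  moreover have "inj_on (\<lambda>x. ?X - {x}) {x \<in> ?X. \<exists>b. alternating b (?X - {x})}"
    by (auto simp: inj_on_def)
  ultimately show ?thesis
    using even_card_alternating_Diff[OF X r] by (simp add: card_image)
next
  case False
  have sub: "y (j - 1) \<subseteq> y (Suc j)" using sign_chains_mono[OF y] j by simp
  have S: "y (Suc j) \<in> signed (r + e)" using sign_chainsD(2)[OF y] j by simp
  have c: "card (y (j - 1)) + 1 = r + j" "card (y (Suc j)) = card (y (j - 1)) + 2"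
    using sign_chainsD(3)[OF y] j False by auto
  have "{v. y(j := v) \<in> sign_chains r e} = {v. y (j - 1) \<subseteq> v \<and> v \<subseteq> y (Suc j) \<and> card v = card (y (j - 1)) + 1}"
    using fun_upd_chains_iff[OF y, of j] j False c signed_subset[OF S] by auto
  then show ?thesis using card_sets_between[OF sub signed_finite[OF S] c(2)] by simp
qed

lemma even_card_fun_upd_chains:
  assumes y: "y \<in> sign_chains r e" and j: "j \<le> e" and e: "e > 0" and r: "r > 0"
  shows "even (card {v. y(j := v) \<in> sign_chains r e})"
proof (cases "j < e")
  case False
  then have j: "j = e" using j by simp
  have W: "y (e - 1) \<in> signed (r + e)" "card (y (e - 1)) = r + e - 1"
    using sign_chainsD(2,3)[OF y, of "e - 1"] e by auto
  have "r + e > 0" using r by simp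
  obtain q where q: "0 < q" "q \<le> int (r + e)" "q \<notin> y (e - 1)" "- q \<notin> y (e - 1)"
    "{v \<in> signed (r + e). y (e - 1) \<subseteq> v \<and> card v = r + e} = {insert q (y (e - 1)), insert (- q) (y (e - 1))}"
    by (rule signed_extensions[OF W \<open>r + e > 0\<close>])
  have "{v. y(j := v) \<in> sign_chains r e} = {v \<in> signed (r + e). y (e - 1) \<subseteq> v \<and> card v = r + e}"
    using fun_upd_chains_iff[OF y, of j] j e by auto
  moreover have "insert q (y (e - 1)) \<noteq> insert (- q) (y (e - 1))"
    using q(1,3) by auto
  ultimately show ?thesis using q(5) by simp
qed (use assms even_card_fun_upd_chains_less in blast)

section \<open>Antipodes, hemispheres and the equator\<close>

lemma alternating_uminus: "alternating b X \<Longrightarrow> 0 \<notin> X \<Longrightarrow> alternating (b + 1) (uminus ` X)"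
  unfolding alternating_def
proof (intro ballI)
  fix x assume a: "\<forall>x\<in>X. of_bool (x < 0) = b + of_nat (card {y \<in> X. \<bar>y\<bar> < \<bar>x\<bar>})" "0 \<notin> X" "x \<in> uminus ` X"
  then obtain z where z: "z \<in> X" "x = - z" by blast
  have "{y \<in> uminus ` X. \<bar>y\<bar> < \<bar>x\<bar>} = uminus ` {y \<in> X. \<bar>y\<bar> < \<bar>z\<bar>}" using z by auto
  then have "card {y \<in> uminus ` X. \<bar>y\<bar> < \<bar>x\<bar>} = card {y \<in> X. \<bar>y\<bar> < \<bar>z\<bar>}" by (simp add: card_image)
  moreover have "(of_bool (x < 0) :: bit) = of_bool (z < 0) + 1" using z a(2) by (cases "z < 0"; cases "z = 0") auto
  ultimately show "of_bool (x < 0) = b + 1 + of_nat (card {y \<in> uminus ` X. \<bar>y\<bar> < \<bar>x\<bar>})"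
    using bspec[OF a(1) z(1)] by (simp only: add_ac)
qed

lemma zero_notin_signed: "X \<in> signed n \<Longrightarrow> 0 \<notin> X"
  unfolding signed_def by force

lemma sign_chains_uminus:
  assumes y: "y \<in> sign_chains r e"
  shows "(\<lambda>i. uminus ` y i) \<in> sign_chains r e"
proof -
  have "\<exists>b. alternating b (uminus ` y 0)"
    using sign_chainsD(1,2)[OF y] alternating_uminus zero_notin_signed by blast
  moreover have "uminus ` y i \<subseteq> uminus ` y (Suc i)" if "i < e" for i
    using sign_chainsD(4)[OF y that] by blast
  ultimately show ?thesis
    using sign_chainsD(2,3,5)[OF y] unfolding sign_chains_def
    by (simp add: signed_uminus card_image)
qed

text \<open>The facets of a closed hemisphere. The top member has an entry at every position, so the
  sign at the last position decides the hemisphere, and the antipode exchanges the two.\<close>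

definition upper_chains :: "nat \<Rightarrow> nat \<Rightarrow> (nat \<Rightarrow> int set) set" where
  "upper_chains r e = {y \<in> sign_chains r e. int (r + e) \<in> y e}"

lemma top_in_or_uminus:
  assumes "X \<in> signed n" "card X = n" "n > 0"
  shows "int n \<in> X \<longleftrightarrow> - int n \<notin> X"
proof -
  have "abs ` X = {1..int n}"
    using card_subset_eq[OF _ signed_abs_range[OF assms(1)]] card_image[OF signed_abs_inj[OF assms(1)]] assms(2) by simp
  then have "int n \<in> abs ` X" using assms(3) by simp
  then show ?thesis using assms(1) by (force simp: signed_def abs_if split: if_splits)
qed

lemma sum_chains_upper:
  fixes F :: "(nat \<Rightarrow> int set) \<Rightarrow> bit"
  assumes r: "r > 0"
  shows "(\<Sum>y\<in>sign_chains r e. F y) = (\<Sum>y\<in>upper_chains r e. F y + F (\<lambda>i. uminus ` y i))"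
proof -
  let ?m = "\<lambda>y i. uminus ` y i :: int set"
  have "(\<Sum>y\<in>sign_chains r e. F y) = (\<Sum>y\<in>upper_chains r e. F y) + (\<Sum>y\<in>sign_chains r e - upper_chains r e. F y)"
    by (subst add.commute, rule sum.subset_diff) (auto simp: upper_chains_def finite_chains)
  also have "(\<Sum>y\<in>sign_chains r e - upper_chains r e. F y) = (\<Sum>y\<in>upper_chains r e. F (?m y))"
  proof (rule sum.reindex_bij_witness[of _ ?m ?m])
    fix y assume "y \<in> sign_chains r e - upper_chains r e"
    then have y: "y \<in> sign_chains r e" "int (r + e) \<notin> y e" by (auto simp: upper_chains_def)
    then have "- int (r + e) \<in> y e"
      using top_in_or_uminus[of "y e" "r + e"] sign_chainsD(2,3)[OF y(1), of e] r by auto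
    then have "int (r + e) \<in> uminus ` y e" by (metis imageI minus_minus)
    then show "?m y \<in> upper_chains r e" using sign_chains_uminus[OF y(1)] by (simp add: upper_chains_def)
  next
    fix y assume y: "y \<in> upper_chains r e"
    then have y': "y \<in> sign_chains r e" "int (r + e) \<in> y e" by (auto simp: upper_chains_def)
    then have "- int (r + e) \<notin> y e"
      using sign_chainsD(2)[OF y'(1), of e] by (auto simp: signed_def)
    then have "int (r + e) \<notin> uminus ` y e" by (metis imageE minus_minus)
    then show "?m y \<in> sign_chains r e - upper_chains r e"
      using sign_chains_uminus[OF y'(1)] by (simp add: upper_chains_def)
  qed (auto simp: image_image)
  finally show ?thesis unfolding sum.distrib .
qed

lemma card_upper_chains_0:
  assumes r: "r > 0"
  shows "card (upper_chains r 0) = 1"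
proof -
  \<comment> \<open>The full vector with \<open>+\<close> at the last position \<open>r\<close> and
    signs alternating downwards.\<close>
  define \<sigma> :: "nat \<Rightarrow> int" where "\<sigma> i = (if even (i + r) then int i else - int i)" for i
  define X0 where "X0 = \<sigma> ` {1..r}"
  have abs\<sigma>: "\<bar>\<sigma> i\<bar> = int i" for i by (simp add: \<sigma>_def)
  have inj: "inj \<sigma>" by (rule injI) (metis abs\<sigma> of_nat_eq_iff)
  have X0: "X0 \<in> signed r" unfolding signed_def
  proof (intro CollectI conjI ballI)
    show "X0 \<subseteq> {- int r..int r}" by (auto simp: X0_def \<sigma>_def)
    fix x assume "x \<in> X0"
    then obtain i where i: "i \<in> {1..r}" "x = \<sigma> i" unfolding X0_def by blast
    show "- x \<notin> X0"
    proof
      assume "- x \<in> X0"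
      then obtain j where j: "- x = \<sigma> j" unfolding X0_def by blast
      then have "i = j" using i abs\<sigma>[of i] abs\<sigma>[of j] by simp
      then show False using i j abs\<sigma>[of i] by auto
    qed
  qed
  have cX0: "card X0 = r" unfolding X0_def by (simp add: card_image inj_on_subset[OF inj])
  have rX0: "int r \<in> X0" using r unfolding X0_def by (auto simp: \<sigma>_def intro!: image_eqI[of _ _ r])
  have rank: "card {y \<in> X. \<bar>y\<bar> < \<bar>x\<bar>} = nat \<bar>x\<bar> - 1" if X: "X \<in> signed r" "card X = r" and x: "x \<in> X" for X x
  proof -
    have absX: "abs ` X = {1..int r}"
      using card_subset_eq[OF _ signed_abs_range[OF X(1)]] card_image[OF signed_abs_inj[OF X(1)]] X(2) by simp
    have "\<bar>x\<bar> \<in> {1..int r}" using absX x by blast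
    then have xr: "\<bar>x\<bar> \<le> int r" by simp
    have "abs ` {y \<in> X. \<bar>y\<bar> < \<bar>x\<bar>} = {z \<in> abs ` X. z < \<bar>x\<bar>}" by blast
    also have "\<dots> = {1..<\<bar>x\<bar>}" unfolding absX using xr by auto
    finally have "card (abs ` {y \<in> X. \<bar>y\<bar> < \<bar>x\<bar>}) = nat \<bar>x\<bar> - 1" by (simp add: nat_diff_distrib)
    moreover have "inj_on abs {y \<in> X. \<bar>y\<bar> < \<bar>x\<bar>}"
      using signed_abs_inj[OF X(1)] by (rule inj_on_subset) blast
    ultimately show ?thesis by (simp add: card_image)
  qed
  have alt0: "alternating (of_nat (r - 1)) X0"
    unfolding alternating_def
  proof
    fix x assume x: "x \<in> X0"
    then obtain i where i: "i \<in> {1..r}" "x = \<sigma> i" unfolding X0_def by blast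
    have "(of_nat (r - 1) + of_nat (nat \<bar>x\<bar> - 1) :: bit) = of_nat (r - 1 + (i - 1))"
      by (simp add: i abs\<sigma>)
    also have "\<dots> = of_bool (x < 0)"
    proof (cases "even (r - 1 + (i - 1))")
      case True
      then have "even (i + r)" using i by auto
      then show ?thesis using True i by (simp add: \<sigma>_def of_nat_bit_eq_0_iff del: of_nat_add)
    next
      case False
      then have "odd (i + r)" using i by auto
      moreover have "of_nat (r - 1 + (i - 1)) = (1::bit)"
        using False of_nat_bit_eq_0_iff bit.exhaust by blast
      ultimately show ?thesis using i by (simp add: \<sigma>_def del: of_nat_add)
    qed
    finally show "of_bool (x < 0) = of_nat (r - 1) + (of_nat (card {y \<in> X0. \<bar>y\<bar> < \<bar>x\<bar>}) :: bit)"
      unfolding rank[OF X0 cX0 x] ..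
  qed
  have uniq: "X = X0" if X: "X \<in> signed r" "card X = r" "alternating b X" "int r \<in> X" for X b
  proof (rule card_subset_eq)
    \<comment> \<open>The entry at the last position is positive and has rank \<open>r - 1\<close>,
      which fixes the starting sign.\<close>
    have b: "b + of_nat (r - 1) = 0"
      using X(3,4) rank[OF X(1,2,4)] unfolding alternating_def by auto
    show "X \<subseteq> X0"
    proof
      fix x assume x: "x \<in> X"
      have "\<bar>x\<bar> \<in> {1..int r}" using signed_abs_range[OF X(1)] x by blast
      then have i: "nat \<bar>x\<bar> \<in> {1..r}" by auto
      have "of_bool (x < 0) = b + of_nat (nat \<bar>x\<bar> - 1)"
        using X(3) rank[OF X(1,2) x] x unfolding alternating_def by auto
      also have "\<dots> = (b + of_nat (r - 1)) + (of_nat (r - 1 + (nat \<bar>x\<bar> - 1)))"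
        unfolding of_nat_add by (cases b; cases "of_nat (r - 1) :: bit") simp_all
      also have "\<dots> = of_nat (r - 1 + (nat \<bar>x\<bar> - 1))" unfolding b by simp
      finally have "x < 0 \<longleftrightarrow> odd (r - 1 + (nat \<bar>x\<bar> - 1))"
        using of_nat_bit_eq_0_iff[of "r - 1 + (nat \<bar>x\<bar> - 1)"] by (cases "x < 0") (simp_all del: of_nat_add)
      moreover have "odd (r - 1 + (nat \<bar>x\<bar> - 1)) \<longleftrightarrow> odd (nat \<bar>x\<bar> + r)" using i by auto
      ultimately have "x = \<sigma> (nat \<bar>x\<bar>)" unfolding \<sigma>_def by auto
      then show "x \<in> X0" using i unfolding X0_def by blast
    qed
  qed (use X cX0 signed_finite[OF X0] in auto)
  have "upper_chains r 0 = {(\<lambda>i. {})(0 := X0)}" (is "_ = {?y}")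
  proof (intro equalityI subsetI)
    fix y assume "y \<in> upper_chains r 0"
    then have y: "y \<in> sign_chains r 0" "int r \<in> y 0" by (auto simp: upper_chains_def)
    have "y 0 = X0" using sign_chainsD(1-3)[OF y(1)] y(2) uniq[of "y 0"] by auto
    then have "y i = ?y i" for i using sign_chainsD(5)[OF y(1), of i] by (cases "i = 0") auto
    then have "y = ?y" by blast
    then show "y \<in> {?y}" by simp
  next
    fix y assume "y \<in> {?y}"
    then show "y \<in> upper_chains r 0"
      using alt0 X0 cX0 rX0 by (auto simp: upper_chains_def sign_chains_def)
  qed
  then show ?thesis by simp
qed

lemma two_sided_mono: "n \<le> m \<Longrightarrow> two_sided r n \<subseteq> two_sided r m"
  unfolding two_sided_def signed_def by auto

lemma two_sided_uminus:
  assumes "X \<in> two_sided r n" shows "uminus ` X \<in> two_sided r n"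
proof -
  obtain b v where v: "X \<in> signed n" "v \<subseteq> X" "alternating b v" "card v = r"
    using assms unfolding two_sided_def by blast
  have "alternating (b + 1) (uminus ` v)"
    using alternating_uminus v zero_notin_signed by blast
  moreover have "card (uminus ` v) = r" using v by (simp add: card_image)
  moreover have "uminus ` v \<subseteq> uminus ` X" using v by blast
  ultimately show ?thesis unfolding two_sided_def using signed_uminus[OF v(1)] by blast
qed

lemma even_card_fun_upd_upper_chains:
  assumes y: "y \<in> upper_chains r e" and j: "j < e" and r: "r > 0"
  shows "even (card {v. y(j := v) \<in> upper_chains r e})"
proof -
  have "{v. y(j := v) \<in> upper_chains r e} = {v. y(j := v) \<in> sign_chains r e}"
    using y j unfolding upper_chains_def by auto
  then show ?thesis using even_card_fun_upd_chains_less[of y r e j] assms by (simp add: upper_chains_def)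
qed

text \<open>This describes the boundary of the hemisphere: if the last step of a chain fills the
  last position, all smaller members live on the first \<open>r + e\<close> positions and form a
  facet of the equator.\<close>

lemma sign_chains_Suc_iff:
  assumes "y \<in> sign_chains r (Suc e)"
  shows "int (r + Suc e) \<in> y (Suc e) \<and> int (r + Suc e) \<notin> y e \<longleftrightarrow>
    y(Suc e := {}) \<in> sign_chains r e \<and> y (Suc e) = insert (int (r + Suc e)) (y e)"
proof
  let ?n = "int (r + Suc e)"
  assume a: "?n \<in> y (Suc e) \<and> ?n \<notin> y e"
  note c = sign_chainsD[OF assms]
  have fin: "finite (y (Suc e))" using c(2)[of "Suc e"] signed_finite by blast
  have sub: "insert ?n (y e) \<subseteq> y (Suc e)" using a c(4)[of e] by auto
  have "finite (y e)" using c(4)[of e] fin finite_subset by blast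
  then have "card (insert ?n (y e)) = card (y (Suc e))" using a c(3)[of e] c(3)[of "Suc e"] by simp
  then have eq: "insert ?n (y e) = y (Suc e)" using card_subset_eq[OF fin sub] by blast
  have "- ?n \<notin> y (Suc e)" using a c(2)[of "Suc e"] unfolding signed_def by blast
  then have ne: "?n \<notin> y e" "- ?n \<notin> y e" using a sub by auto
  have "y i \<in> signed (r + e)" if "i \<le> e" for i
  proof -
    have "y i \<subseteq> y e" using sign_chains_mono[OF assms that] by simp
    then have n: "?n \<notin> y i" "- ?n \<notin> y i" using ne by auto
    have s: "y i \<in> signed (r + Suc e)" using c(2) that by simp
    have "y i \<subseteq> {- int (r + e)..int (r + e)}"
    proof
      fix x assume x: "x \<in> y i"
      then have "- ?n \<le> x" "x \<le> ?n" "x \<noteq> ?n" "x \<noteq> - ?n" using s n unfolding signed_def by auto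
      then show "x \<in> {- int (r + e)..int (r + e)}" by auto
    qed
    then show ?thesis using s unfolding signed_def by blast
  qed
  then have "y(Suc e := {}) \<in> sign_chains r e"
    using c unfolding sign_chains_def by auto
  then show "y(Suc e := {}) \<in> sign_chains r e \<and> y (Suc e) = insert ?n (y e)" using eq by simp
next
  let ?n = "int (r + Suc e)"
  assume a: "y(Suc e := {}) \<in> sign_chains r e \<and> y (Suc e) = insert ?n (y e)"
  have "y e \<in> signed (r + e)" using sign_chainsD(2)[of _ r e e, OF conjunct1[OF a]] by simp
  then show "?n \<in> y (Suc e) \<and> ?n \<notin> y e" using a unfolding signed_def by auto
qed

lemma sign_chains_extend:
  assumes "y \<in> sign_chains r e"
  shows "y(Suc e := insert (int (r + Suc e)) (y e)) \<in> sign_chains r (Suc e)"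
proof -
  let ?n = "int (r + Suc e)"
  note c = sign_chainsD[OF assms]
  have s: "y i \<in> signed (r + Suc e)" if "i \<le> e" for i
    using c(2)[OF that] unfolding signed_def by auto
  have n: "?n \<notin> y e" "- ?n \<notin> y e" using c(2)[of e] unfolding signed_def by auto
  have "insert ?n (y e) \<in> signed (r + Suc e)"
    unfolding signed_def
  proof (intro CollectI conjI ballI)
    show "insert ?n (y e) \<subseteq> {- int (r + Suc e)..int (r + Suc e)}"
      using s[of e] unfolding signed_def by auto
    fix x assume x: "x \<in> insert ?n (y e)"
    have "- x \<noteq> ?n"
    proof
      assume "- x = ?n"
      then have "x = - ?n" by simp
      then show False using x n(2) by auto
    qed
    moreover have "- x \<notin> y e" using x n s[of e] unfolding signed_def by auto
    ultimately show "- x \<notin> insert ?n (y e)" by blast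
  qed
  moreover have "card (insert ?n (y e)) = r + Suc e"
    using c(3)[of e] n signed_finite[OF s[of e]] by simp
  ultimately show ?thesis
    using c s unfolding sign_chains_def by (auto simp: le_Suc_eq less_Suc_eq)
qed

text \<open>A discrete Stokes formula for an \<open>F\<close> that ignores the top member. If
  position \<open>r + Suc e\<close> is filled before the top, every exchange of the top stays in the
  hemisphere, and these chains cancel; the others are facets of the equator with a forced
  top.\<close>

lemma sum_upper_chains_Suc:
  fixes F :: "(nat \<Rightarrow> int set) \<Rightarrow> bit"
  assumes r: "r > 0" and F: "\<And>y v. F (y(Suc e := v)) = F y"
  shows "(\<Sum>y\<in>upper_chains r (Suc e). F y) = (\<Sum>y\<in>sign_chains r e. F y)"
proof -
  let ?n = "int (r + Suc e)"
  let ?U = "upper_chains r (Suc e)"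
  let ?V = "{y \<in> ?U. ?n \<in> y e}"
  have fin: "finite ?U" by (simp add: upper_chains_def finite_chains)
  have "(\<Sum>y\<in>?U. F y) = (\<Sum>y\<in>?U - ?V. F y) + (\<Sum>y\<in>?V. F y)"
    by (rule sum.subset_diff) (auto simp: fin)
  also have "(\<Sum>y\<in>?V. F y) = 0"
  proof (rule sum_fun_upd_cancel[where j = "Suc e"])
    fix y assume "y \<in> ?V"
    then have y: "y \<in> sign_chains r (Suc e)" "?n \<in> y e" by (auto simp: upper_chains_def)
    have "y(Suc e := v) \<in> ?V \<longleftrightarrow> y(Suc e := v) \<in> sign_chains r (Suc e)" for v
    proof
      assume v: "y(Suc e := v) \<in> sign_chains r (Suc e)"
      have "y e \<subseteq> v" using sign_chainsD(4)[OF v, of e] by simp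
      then show "y(Suc e := v) \<in> ?V" using v y(2) by (auto simp: upper_chains_def)
    qed (auto simp: upper_chains_def)
    then show "even (card {v. y(Suc e := v) \<in> ?V})"
      using even_card_fun_upd_chains[OF y(1), of "Suc e"] r by simp
  qed (use fin F in auto)
  also have "(\<Sum>y\<in>?U - ?V. F y) = (\<Sum>y\<in>sign_chains r e. F y)"
  proof (rule sum.reindex_bij_witness[of _ "\<lambda>y. y(Suc e := insert ?n (y e))" "\<lambda>y. y(Suc e := {})"])
    fix y assume "y \<in> ?U - ?V"
    then have y: "y \<in> sign_chains r (Suc e)" "?n \<in> y (Suc e) \<and> ?n \<notin> y e" by (auto simp: upper_chains_def)
    note * = sign_chains_Suc_iff[OF y(1), THEN iffD1, OF y(2)]
    show "y(Suc e := {}) \<in> sign_chains r e" using * by blast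
    have "(y(Suc e := {}))(Suc e := insert ?n ((y(Suc e := {})) e)) = y(Suc e := insert ?n (y e))" by simp
    also have "\<dots> = y(Suc e := y (Suc e))" using * by (simp only:)
    finally show "(y(Suc e := {}))(Suc e := insert ?n ((y(Suc e := {})) e)) = y" by simp
  next
    fix y assume y: "y \<in> sign_chains r e"
    have "?n \<notin> y e" using sign_chainsD(2)[OF y, of e] unfolding signed_def by auto
    then show "y(Suc e := insert ?n (y e)) \<in> ?U - ?V"
      using sign_chains_extend[OF y] by (simp add: upper_chains_def)
    show "(y(Suc e := insert ?n (y e)))(Suc e := {}) = y"
      using sign_chainsD(5)[OF y, of "Suc e"] by (simp add: fun_upd_idem)
  qed (simp add: F)
  finally show ?thesis by simp
qed

text \<open>The antipode swaps the starting sign, so each chain of the hemisphere contributes both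
  terms on the right of \<open>sum_alt_seq_skip\<close>, which are then traded for its
  faces.\<close>

lemma sum_alternating_chains_upper:
  assumes r: "r > 0" and g: "\<And>X. X \<in> two_sided r (r + e) \<Longrightarrow> g (uminus ` X) = g X + (1::bit)"
  shows "(\<Sum>y\<in>sign_chains r e. of_bool (alt_seq 0 (Suc e) (g \<circ> y))) =
    (\<Sum>j\<le>e. \<Sum>y\<in>upper_chains r e. of_bool (alt_seq 0 e (g \<circ> y \<circ> skip j)) :: bit)"
proof -
  have alt: "alt_seq 0 (Suc e) (g \<circ> (\<lambda>i. uminus ` y i)) \<longleftrightarrow> alt_seq (0 + 1) (Suc e) (g \<circ> y)"
    if "y \<in> upper_chains r e" for y
  proof -
    have *: "g (uminus ` y i) = g (y i) + 1" if "i < Suc e" for i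
      using g sign_chains_two_sided[of y r e i] \<open>y \<in> upper_chains r e\<close> that by (auto simp: upper_chains_def)
    have "x + 1 = b \<longleftrightarrow> x = 1 + b" for x b :: bit by (cases x; cases b) simp_all
    then show ?thesis unfolding alt_seq_def by (simp only: comp_apply * add_0_left cong: imp_cong)
  qed
  have swap: "(\<Sum>j\<le>e. \<Sum>y\<in>upper_chains r e. of_bool (alt_seq 0 e (g \<circ> y \<circ> skip j)) :: bit) =
    (\<Sum>y\<in>upper_chains r e. \<Sum>j\<le>e. of_bool (alt_seq 0 e (g \<circ> y \<circ> skip j)))"
    by (rule sum.swap)
  show ?thesis
    unfolding sum_chains_upper[OF r] swap sum_alt_seq_skip
    by (rule sum.cong[OF refl], rule arg_cong2[where f = "(+)", OF refl]) (simp only: alt)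
qed

text \<open>A sign version of Fan's lemma, by induction over the equators of the sphere.\<close>

theorem sum_alternating_chains:
  assumes r: "r > 0" and g: "\<And>X. X \<in> two_sided r (r + e) \<Longrightarrow> g (uminus ` X) = g X + (1::bit)"
  shows "(\<Sum>y\<in>sign_chains r e. of_bool (alt_seq 0 (Suc e) (g \<circ> y))) = (1::bit)"
  using g
proof (induction e)
  case 0
  show ?case
    using sum_alternating_chains_upper[of r 0 g, OF r 0] by (simp add: alt_seq_def card_upper_chains_0[OF r])
next
  case (Suc e)
  have anti: "(\<Sum>y\<in>sign_chains r (Suc e). of_bool (alt_seq 0 (Suc (Suc e)) (g \<circ> y))) =
    (\<Sum>j\<le>Suc e. \<Sum>y\<in>upper_chains r (Suc e). of_bool (alt_seq 0 (Suc e) (g \<circ> y \<circ> skip j)) :: bit)"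
    using r Suc.prems by (rule sum_alternating_chains_upper)
  have upd: "alt_seq 0 (Suc e) (g \<circ> y(j := v) \<circ> skip j) \<longleftrightarrow> alt_seq 0 (Suc e) (g \<circ> y \<circ> skip j)" for y j v
    by (simp add: alt_seq_def skip_def)
  \<comment> \<open>Deleting entry \<open>j \<le> e\<close> makes the summand blind to member
    \<open>j\<close>, which has evenly many exchanges inside the hemisphere. Only the deletion of
    the top survives, and it leads to the equator.\<close>
  have zero: "(\<Sum>y\<in>upper_chains r (Suc e). of_bool (alt_seq 0 (Suc e) (g \<circ> y \<circ> skip j)) :: bit) = 0" if "j \<le> e" for j
  proof (rule sum_fun_upd_cancel[where j = j])
    show "even (card {v. y(j := v) \<in> upper_chains r (Suc e)})" if "y \<in> upper_chains r (Suc e)" for y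
      using even_card_fun_upd_upper_chains[OF that _ r] \<open>j \<le> e\<close> by simp
  qed (simp_all only: upd, simp add: upper_chains_def finite_chains)
  have "(\<Sum>j\<le>e. \<Sum>y\<in>upper_chains r (Suc e). of_bool (alt_seq 0 (Suc e) (g \<circ> y \<circ> skip j)) :: bit) = 0"
  proof (intro sum.neutral[of "{..e}"] ballI)
    fix j assume "j \<in> {..e}"
    then show "(\<Sum>y\<in>upper_chains r (Suc e). of_bool (alt_seq 0 (Suc e) (g \<circ> y \<circ> skip j)) :: bit) = 0"
      by (intro zero) simp
  qed
  then have "(\<Sum>y\<in>sign_chains r (Suc e). of_bool (alt_seq 0 (Suc (Suc e)) (g \<circ> y)) :: bit) =
      (\<Sum>y\<in>upper_chains r (Suc e). of_bool (alt_seq 0 (Suc e) (g \<circ> y \<circ> skip (Suc e))))"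
    unfolding anti sum.atMost_Suc by (simp only: add_0_left)
  also have "\<dots> = (\<Sum>y\<in>sign_chains r e. of_bool (alt_seq 0 (Suc e) (g \<circ> y \<circ> skip (Suc e))))"
    by (rule sum_upper_chains_Suc[OF r]) (simp only: upd)
  also have "\<dots> = (\<Sum>y\<in>sign_chains r e. of_bool (alt_seq 0 (Suc e) (g \<circ> y)))"
    by (simp add: alt_seq_def skip_def cong: conj_cong)
  also have "\<dots> = 1"
    using Suc.prems two_sided_mono[of "r + e" "r + Suc e" r] by (intro Suc.IH) auto
  finally show ?case .
qed

section \<open>Chains split between two labellings\<close>

text \<open>The count behind Sperner's lemma: if all of \<open>insert b A\<close> occurs, only the
  preimage of \<open>b\<close> can be left out; if exactly \<open>A\<close> occurs, one value is
  doubled and either of its two preimages can be left out.\<close>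

lemma sum_image_Diff_eq:
  assumes I: "finite I" "card I = Suc (card A)" and A: "finite A" "b \<notin> A" "f ` I \<subseteq> insert b A"
  shows "(\<Sum>j\<in>I. of_bool (f ` (I - {j}) = A)) = (of_bool (f ` I = insert b A) :: bit)"
proof -
  have sum: "(\<Sum>j\<in>I. of_bool (f ` (I - {j}) = A)) = (of_nat (card {j \<in> I. f ` (I - {j}) = A}) :: bit)"
    using I by (simp add: Int_def)
  consider "f ` I = insert b A" | "f ` I = A" | "f ` I \<noteq> insert b A" "f ` I \<noteq> A" by blast
  then show ?thesis
  proof cases
    case 1
    then have inj: "inj_on f I" using I A by (intro eq_card_imp_inj_on) auto
    obtain i where i: "i \<in> I" "f i = b" using 1 by (metis imageE insertI1)
    have "{j \<in> I. f ` (I - {j}) = A} = {i}"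
    proof (intro equalityI subsetI)
      fix j assume j: "j \<in> {j \<in> I. f ` (I - {j}) = A}"
      then have "b \<notin> f ` (I - {j})" using A by blast
      then show "j \<in> {i}" using i j by blast
    next
      fix j assume "j \<in> {i}"
      moreover have "f ` (I - {i}) = A" using inj_on_image_set_diff[OF inj, of I "{i}"] i 1 A by auto
      ultimately show "j \<in> {j \<in> I. f ` (I - {j}) = A}" using i by simp
    qed
    then show ?thesis unfolding sum using 1 by simp
  next
    case 2
    then have "\<not> inj_on f I" using I A card_image by fastforce
    then obtain i i' where ii: "i \<in> I" "i' \<in> I" "i \<noteq> i'" "f i = f i'" unfolding inj_on_def by blast
    have drop: "f ` (I - {x}) = A" if "x \<in> I" "x' \<in> I" "x \<noteq> x'" "f x = f x'" for x x'
    proof -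
      have "f x \<in> f ` (I - {x})" using that by (auto intro: image_eqI[of _ _ x'])
      then show ?thesis using that(1) unfolding 2[symmetric] by blast
    qed
    have im: "f ` (I - {i}) = A" using drop[of i i'] ii by blast
    then have inj: "inj_on f (I - {i})" using I A ii by (intro eq_card_imp_inj_on) auto
    have "{j \<in> I. f ` (I - {j}) = A} = {i, i'}"
    proof (intro equalityI subsetI)
      fix j assume j: "j \<in> {j \<in> I. f ` (I - {j}) = A}"
      then have "f j \<in> f ` (I - {j})" using 2 by auto
      then obtain x where "x \<in> I - {j}" "f x = f j" by (metis imageE)
      then have x: "x \<in> I" "x \<noteq> j" "f x = f j" by auto
      show "j \<in> {i, i'}"
      proof (rule ccontr)
        assume n: "j \<notin> {i, i'}"
        define x' where "x' = (if x = i then i' else x)"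
        have "x' \<in> I - {i}" "f x' = f j" "x' \<noteq> j" using x ii n by (auto simp: x'_def)
        then show False using inj n j by (auto dest: inj_onD)
      qed
    next
      fix j assume j: "j \<in> {i, i'}"
      have "f ` (I - {i'}) = A" using drop[of i' i] ii by simp
      then show "j \<in> {j \<in> I. f ` (I - {j}) = A}" using im ii j by auto
    qed
    moreover have "A \<noteq> insert b A" using A by blast
    ultimately show ?thesis unfolding sum using 2 ii(3) by simp
  next
    case 3
    have "f ` (I - {j}) \<noteq> A" if "j \<in> I" for j
    proof
      assume a: "f ` (I - {j}) = A"
      have "f ` I = insert (f j) A" using a that by blast
      then show False using 3 A(3) that by auto
    qed
    then have "{j \<in> I. f ` (I - {j}) = A} = {}" by blast
    then show ?thesis unfolding sum using 3 by (simp only: card.empty) simp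
  qed
qed

text \<open>The member with index \<open>card A - 1\<close> is read by both labellings, so the
  \<open>e + 1\<close> members of a chain provide \<open>e + 2\<close> labels. The number of such
  chains is taken modulo 2.\<close>

definition split_chains :: "nat \<Rightarrow> nat \<Rightarrow> (int set \<Rightarrow> nat) \<Rightarrow> (int set \<Rightarrow> nat) \<Rightarrow> nat set \<Rightarrow> nat set \<Rightarrow> bit" where
  "split_chains r e p q A B = (\<Sum>y\<in>sign_chains r e.
     of_bool ((\<lambda>i. p (y i)) ` {..<card A} = A) * of_bool ((\<lambda>i. q (y i)) ` {card A - 1..e} = B))"

lemma sum_chains_cancel:
  fixes F :: "(nat \<Rightarrow> int set) \<Rightarrow> bit"
  assumes "r > 0" "e > 0" "j \<le> e" "\<And>y v. F (y(j := v)) = F y"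
  shows "(\<Sum>y\<in>sign_chains r e. F y) = 0"
  by (rule sum_fun_upd_cancel[where j = j]) (use assms even_card_fun_upd_chains finite_chains in auto)

text \<open>Both sides count the boundary faces of the cells
  \<open>p (y 0), \<dots>, p (y i), q (y i), \<dots>, q (y e)\<close> of the prism between \<open>p\<close> and \<open>q\<close> whose \<open>p\<close>-part is \<open>A\<close>
  and whose \<open>q\<close>-part is \<open>B\<close>; deleting an entry whose chain element occurs only once cancels.\<close>

lemma split_chains_move:
  assumes r: "r > 0"
    and col: "\<And>y i. y \<in> sign_chains r e \<Longrightarrow> i \<le> e \<Longrightarrow> p (y i) \<le> Suc e \<and> q (y i) \<le> Suc e"
    and ne: "\<And>y i j. y \<in> sign_chains r e \<Longrightarrow> i \<le> e \<Longrightarrow> j \<le> e \<Longrightarrow> p (y i) \<noteq> q (y j)"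
    and AB: "A \<noteq> {}" "B \<noteq> {}" "A \<inter> B = {}" "b \<notin> A" "b \<notin> B" "insert b (A \<union> B) = {..Suc e}"
  shows "split_chains r e p q (insert b A) B = split_chains r e p q A (insert b B)"
proof -
  have fin: "finite A" "finite B" using AB(6) by (metis finite_atMost finite_Un finite_insert)+
  have "card {..Suc e} = Suc (card A + card B)"
    unfolding AB(6)[symmetric] using AB(3-5) fin by (simp add: card_Un_disjoint)
  then have cards: "card A + card B = Suc e" by simp
  define l where "l = card A"
  have l: "0 < l" "l \<le> e" "card B = Suc e - l" "e > 0"
  proof -
    have "card A > 0" "card B > 0" using AB(1,2) fin by (auto simp: card_gt_0_iff)
    then show "0 < l" "l \<le> e" "card B = Suc e - l" "e > 0" using cards by (auto simp: l_def)
  qed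
  let ?P = "\<lambda>S y. (of_bool ((\<lambda>i. p (y i)) ` S = A) :: bit)"
  let ?Q = "\<lambda>S y. (of_bool ((\<lambda>i. q (y i)) ` S = B) :: bit)"
  \<comment> \<open>Once the \<open>q\<close>-part is exactly \<open>B\<close>, no
    \<open>p\<close>-label of the chain lies in \<open>B\<close>. So the \<open>p\<close>-part stays
    inside \<open>insert b A\<close> and \<open>sum_image_Diff_eq\<close> applies.\<close>
  have 1: "of_bool ((\<lambda>i. p (y i)) ` {..<Suc l} = insert b A) * ?Q {l..e} y =
      (\<Sum>j\<in>{..<Suc l}. ?P ({..<Suc l} - {j}) y * ?Q {l..e} y)" if y: "y \<in> sign_chains r e" for y
  proof (cases "(\<lambda>i. q (y i)) ` {l..e} = B")
    case True
    have "p (y i) \<in> insert b A" if "i < Suc l" for i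
    proof -
      have "p (y i) \<notin> B" unfolding True[symmetric] using ne[OF y] that l by auto
      moreover have "p (y i) \<in> insert b (A \<union> B)" unfolding AB(6) using col[OF y] that l by simp
      ultimately show ?thesis by blast
    qed
    then have "(\<Sum>j\<in>{..<Suc l}. ?P ({..<Suc l} - {j}) y) = of_bool ((\<lambda>i. p (y i)) ` {..<Suc l} = insert b A)"
      by (intro sum_image_Diff_eq) (use fin AB in \<open>auto simp: l_def\<close>)
    then show ?thesis unfolding sum_distrib_right[symmetric] by simp
  qed simp
  have 2: "?P {..<l} y * of_bool ((\<lambda>i. q (y i)) ` {l - 1..e} = insert b B) =
      (\<Sum>j\<in>{l - 1..e}. ?P {..<l} y * ?Q ({l - 1..e} - {j}) y)" if y: "y \<in> sign_chains r e" for y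
  proof (cases "(\<lambda>i. p (y i)) ` {..<l} = A")
    case True
    have "q (y i) \<in> insert b B" if "i \<in> {l - 1..e}" for i
    proof -
      have "p (y i') \<noteq> q (y i)" if "i' < l" for i'
        using ne[OF y, of i' i] that \<open>i \<in> {l - 1..e}\<close> l by simp
      then have "q (y i) \<notin> A" unfolding True[symmetric] by (metis imageE lessThan_iff)
      moreover have "q (y i) \<in> insert b (A \<union> B)" unfolding AB(6) using col[OF y] that l by simp
      ultimately show ?thesis by blast
    qed
    then have im: "(\<lambda>i. q (y i)) ` {l - 1..e} \<subseteq> insert b B" by blast
    have c: "card {l - 1..e} = Suc (card B)" using l by simp
    have "(\<Sum>j\<in>{l - 1..e}. ?Q ({l - 1..e} - {j}) y) = of_bool ((\<lambda>i. q (y i)) ` {l - 1..e} = insert b B)"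
      by (rule sum_image_Diff_eq[OF finite_atLeastAtMost c fin(2) AB(5) im])
    then show ?thesis unfolding sum_distrib_left[symmetric] by simp
  qed simp
  \<comment> \<open>The faces on which no member is read twice. Such a face arises on the left by
    deleting the \<open>p\<close>-label of the turning member \<open>l\<close>, and on the right by
    deleting the \<open>q\<close>-label of the turning member \<open>l - 1\<close>.\<close>
  let ?D = "\<Sum>y\<in>sign_chains r e. ?P {..<l} y * ?Q {l..e} y"
  have "split_chains r e p q (insert b A) B =
      (\<Sum>y\<in>sign_chains r e. \<Sum>j\<in>{..<Suc l}. ?P ({..<Suc l} - {j}) y * ?Q {l..e} y)"
    unfolding split_chains_def using 1 AB(4) fin by (intro sum.cong refl) (simp add: l_def)
  also have "\<dots> = (\<Sum>j\<in>{..<Suc l}. \<Sum>y\<in>sign_chains r e. ?P ({..<Suc l} - {j}) y * ?Q {l..e} y)"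
    by (rule sum.swap)
  also have "\<dots> = (\<Sum>j\<in>{..<Suc l}. if j = l then ?D else 0)"
  proof (rule sum.cong[OF refl])
    fix j assume j: "j \<in> {..<Suc l}"
    show "(\<Sum>y\<in>sign_chains r e. ?P ({..<Suc l} - {j}) y * ?Q {l..e} y) = (if j = l then ?D else 0)"
    proof (cases "j = l")
      case True
      have "{..<Suc l} - {l} = {..<l}" by auto
      then show ?thesis using True by simp
    next
      case False
      have "(\<Sum>y\<in>sign_chains r e. ?P ({..<Suc l} - {j}) y * ?Q {l..e} y) = 0"
      proof (rule sum_chains_cancel[of _ _ j])
        fix y :: "nat \<Rightarrow> int set" and v
        have "(\<lambda>i. p ((y(j := v)) i)) ` ({..<Suc l} - {j}) = (\<lambda>i. p (y i)) ` ({..<Suc l} - {j})"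
          by (rule image_cong) auto
        moreover have "(\<lambda>i. q ((y(j := v)) i)) ` {l..e} = (\<lambda>i. q (y i)) ` {l..e}"
          by (rule image_cong) (use j False in auto)
        ultimately show "?P ({..<Suc l} - {j}) (y(j := v)) * ?Q {l..e} (y(j := v)) = ?P ({..<Suc l} - {j}) y * ?Q {l..e} y"
          by (simp only:)
      qed (use r l j in auto)
      then show ?thesis using False by simp
    qed
  qed
  also have "\<dots> = ?D" by simp
  also have "\<dots> = (\<Sum>j\<in>{l - 1..e}. if j = l - 1 then ?D else 0)" using l by simp
  also have "\<dots> = (\<Sum>j\<in>{l - 1..e}. \<Sum>y\<in>sign_chains r e. ?P {..<l} y * ?Q ({l - 1..e} - {j}) y)"
  proof (rule sum.cong[OF refl])
    fix j assume j: "j \<in> {l - 1..e}"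
    show "(if j = l - 1 then ?D else 0) = (\<Sum>y\<in>sign_chains r e. ?P {..<l} y * ?Q ({l - 1..e} - {j}) y)"
    proof (cases "j = l - 1")
      case True
      have "{l - 1..e} - {l - 1} = {l..e}" using l by auto
      then show ?thesis using True by simp
    next
      case False
      have "(\<Sum>y\<in>sign_chains r e. ?P {..<l} y * ?Q ({l - 1..e} - {j}) y) = 0"
      proof (rule sum_chains_cancel[of _ _ j])
        fix y :: "nat \<Rightarrow> int set" and v
        have "(\<lambda>i. q ((y(j := v)) i)) ` ({l - 1..e} - {j}) = (\<lambda>i. q (y i)) ` ({l - 1..e} - {j})"
          by (rule image_cong) auto
        moreover have "(\<lambda>i. p ((y(j := v)) i)) ` {..<l} = (\<lambda>i. p (y i)) ` {..<l}"
          by (rule image_cong) (use j False in auto)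
        ultimately show "?P {..<l} (y(j := v)) * ?Q ({l - 1..e} - {j}) (y(j := v)) = ?P {..<l} y * ?Q ({l - 1..e} - {j}) y"
          by (simp only:)
      qed (use r l j in auto)
      then show ?thesis using False by simp
    qed
  qed
  also have "\<dots> = (\<Sum>y\<in>sign_chains r e. \<Sum>j\<in>{l - 1..e}. ?P {..<l} y * ?Q ({l - 1..e} - {j}) y)"
    by (rule sum.swap)
  also have "\<dots> = split_chains r e p q A (insert b B)"
    unfolding split_chains_def l_def[symmetric] using 2 by (intro sum.cong refl) (simp only:)
  finally show ?thesis .
qed

lemma strict_mono_eq_Suc:
  fixes f :: "nat \<Rightarrow> nat"
  assumes mono: "\<And>i. i < e \<Longrightarrow> f i < f (Suc i)" and "f 0 > 0" "f e \<le> Suc e" "i \<le> e"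
  shows "f i = Suc i"
proof (rule antisym)
  show "f i \<le> Suc i" using \<open>i \<le> e\<close>
  proof (induction i rule: inc_induct)
    case (step i) then show ?case using mono[of i] by simp
  qed (use assms in simp)
  show "Suc i \<le> f i" using \<open>i \<le> e\<close>
  proof (induction i)
    case (Suc i) then show ?case using mono[of i] by simp
  qed (use assms in simp)
qed

text \<open>Applied to consecutive members of a chain, with \<open>a\<close>, \<open>c\<close> the
  labels under \<open>p\<close> and \<open>b\<close>, \<open>d\<close> those under \<open>q\<close>:
  an unchanged maximum cannot change sides, since both sides would then share that label.\<close>

lemma less_iff_less:
  fixes a b c d :: nat
  assumes "max c d = max a b" "a \<le> c" "b \<le> d" "a \<noteq> d" "c \<noteq> b" "a \<noteq> b" "c \<noteq> d"
  shows "a < b \<longleftrightarrow> c < d"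
  using assms by (cases "a < b"; cases "c < d") (simp_all add: max_def split: if_splits)

text \<open>Records on which side the largest colour occurs, twisted by the parity of that colour. Since the
  largest colour is monotone along a chain, alternation forces it to run through all positive
  values.\<close>

definition max_sign :: "(int set \<Rightarrow> nat) \<Rightarrow> int set \<Rightarrow> bit" where
  "max_sign p X = of_nat (max (p X) (p (uminus ` X))) + 1 + of_bool (p X < p (uminus ` X))"

text \<open>This turns the odd count of alternating chains into the initial split. An unchanged
  maximum would keep its side and hence its \<open>max_sign\<close>, so the maximum rises at every
  step; the sign bit then puts all of \<open>{1..Suc e}\<close> on the side of
  \<open>p\<close>.\<close>

lemma alternating_max_sign_iff:
  assumes y: "y \<in> sign_chains r e" and N: "N = r + e"
    and col: "\<And>X. X \<in> two_sided r N \<Longrightarrow> p X \<le> Suc e"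
    and mono: "\<And>X Y. X \<in> two_sided r N \<Longrightarrow> Y \<in> two_sided r N \<Longrightarrow> X \<subseteq> Y \<Longrightarrow> p X \<le> p Y"
    and ne: "\<And>i j. i \<le> e \<Longrightarrow> j \<le> e \<Longrightarrow> p (y i) \<noteq> p (uminus ` y j)"
  shows "alt_seq 0 (Suc e) (max_sign p \<circ> y) \<longleftrightarrow>
    (\<lambda>i. p (y i)) ` {..e} = {1..Suc e} \<and> (\<lambda>i. p (uminus ` y i)) ` {e..e} = {0}"
proof -
  let ?q = "\<lambda>X. p (uminus ` X)"
  have ts: "y i \<in> two_sided r N" "uminus ` y i \<in> two_sided r N" if "i \<le> e" for i
    using sign_chains_two_sided[OF y that] two_sided_uminus unfolding N by blast+
  have pm: "p (y i) \<le> p (y (Suc i))" "?q (y i) \<le> ?q (y (Suc i))" if "i < e" for i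
  proof -
    have "y i \<subseteq> y (Suc i)" by (rule sign_chainsD(4)[OF y that])
    then show "p (y i) \<le> p (y (Suc i))" "?q (y i) \<le> ?q (y (Suc i))"
      using ts[of i] ts[of "Suc i"] that by (auto intro!: mono image_mono)
  qed
  define M where "M i = max (p (y i)) (?q (y i))" for i
  have Mle: "M i \<le> Suc e" if "i \<le> e" for i
    using ts[OF that] col unfolding M_def by simp
  show ?thesis
  proof
    assume alt: "alt_seq 0 (Suc e) (max_sign p \<circ> y)"
    have sign: "of_nat (M i) + 1 + of_bool (p (y i) < ?q (y i)) = (of_nat i :: bit)" if "i \<le> e" for i
      using alt that unfolding alt_seq_def max_sign_def M_def by (simp only: comp_apply add_0_left less_Suc_eq_le)
    have "M i = Suc i" if "i \<le> e" for i
    proof (rule strict_mono_eq_Suc[OF _ _ _ that])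
      \<comment> \<open>The two labels differ, so the larger one is positive.\<close>
      show "M 0 > 0" using ne[of 0 0] unfolding M_def by auto
      show "M e \<le> Suc e" by (rule Mle) simp
      fix i assume i: "i < e"
      show "M i < M (Suc i)"
      proof (rule ccontr)
        assume "\<not> M i < M (Suc i)"
        then have eq: "M (Suc i) = M i" using pm[OF i] unfolding M_def by linarith
        have "p (y i) < ?q (y i) \<longleftrightarrow> p (y (Suc i)) < ?q (y (Suc i))"
        proof (rule less_iff_less)
          show "max (p (y (Suc i))) (?q (y (Suc i))) = max (p (y i)) (?q (y i))"
            using eq unfolding M_def .
        qed (use pm[OF i] ne i in auto)
        then have "of_nat i = (of_nat (Suc i) :: bit)"
          using sign[of i] sign[of "Suc i"] i unfolding eq by simp
        then show False by (cases "of_nat i :: bit") simp_all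
      qed
    qed
    note MS = this
    have pS: "p (y i) = Suc i" if "i \<le> e" for i
    proof -
      have "\<not> p (y i) < ?q (y i)"
        using sign[OF that] MS[OF that] by (cases "of_nat i :: bit") (auto split: if_splits)
      then show ?thesis using MS[OF that] unfolding M_def by simp
    qed
    \<comment> \<open>All positive labels are taken by \<open>p\<close>, and \<open>q\<close> shares
      none of them.\<close>
    have "?q (y e) = 0"
    proof (rule ccontr)
      assume n: "?q (y e) \<noteq> 0"
      have "?q (y e) \<le> Suc e" using ts[of e] col by simp
      then have "p (y (?q (y e) - 1)) = ?q (y e)" using pS[of "?q (y e) - 1"] n by simp
      moreover have "?q (y e) - 1 \<le> e" using \<open>?q (y e) \<le> Suc e\<close> by simp
      ultimately show False using ne[OF _ order_refl] by blast
    qed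
    moreover have "(\<lambda>i. p (y i)) ` {..e} = {1..Suc e}"
    proof -
      have "(\<lambda>i. p (y i)) ` {..e} = Suc ` {..e}" using pS by (intro image_cong) auto
      then show ?thesis by (simp add: image_Suc_atMost)
    qed
    ultimately show "(\<lambda>i. p (y i)) ` {..e} = {1..Suc e} \<and> (\<lambda>i. ?q (y i)) ` {e..e} = {0}" by simp
  next
    assume a: "(\<lambda>i. p (y i)) ` {..e} = {1..Suc e} \<and> (\<lambda>i. ?q (y i)) ` {e..e} = {0}"
    have inj: "inj_on (\<lambda>i. p (y i)) {..e}"
      by (rule eq_card_imp_inj_on) (use a in simp_all)
    have "p (y i) \<in> {1..Suc e}" if "i \<le> e" for i using a that by blast
    then have p0: "p (y i) > 0" if "i \<le> e" for i using that by fastforce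
    have pS: "p (y i) = Suc i" if "i \<le> e" for i
    proof (rule strict_mono_eq_Suc[OF _ _ _ that])
      show "p (y 0) > 0" using p0 by simp
      show "p (y e) \<le> Suc e" using ts[of e] col by simp
      fix i assume i: "i < e"
      then have "p (y i) \<noteq> p (y (Suc i))" using inj_onD[OF inj, of i "Suc i"] by auto
      then show "p (y i) < p (y (Suc i))" using pm[OF i] by simp
    qed
    have "?q (y i) = 0" if "i \<le> e" for i
    proof -
      have "?q (y i) \<le> ?q (y e)"
        using that by (intro mono ts image_mono sign_chains_mono[OF y]) simp_all
      then show ?thesis using a by simp
    qed
    then show "alt_seq 0 (Suc e) (max_sign p \<circ> y)"
      unfolding alt_seq_def max_sign_def using pS by (auto simp: bit_add_self)
  qed
qed

text \<open>The split with only 0 on the \<open>q\<close> side has an odd count by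
  \<open>sum_alternating_chains\<close>, and \<open>split_chains_move\<close> carries the other
  colours of \<open>B\<close> over one at a time. The witness \<open>X\<close> is the top of a
  counted chain.\<close>

theorem exists_split_chain:
  fixes p :: "int set \<Rightarrow> nat"
  assumes r: "r > 0"
    and col: "\<And>X. X \<in> two_sided r (r + e) \<Longrightarrow> p X \<le> Suc e"
    and mono: "\<And>X Y. X \<in> two_sided r (r + e) \<Longrightarrow> Y \<in> two_sided r (r + e) \<Longrightarrow> X \<subseteq> Y \<Longrightarrow> p X \<le> p Y"
    and ne: "\<And>X Y. X \<in> two_sided r (r + e) \<Longrightarrow> Y \<in> two_sided r (r + e) \<Longrightarrow> X \<subseteq> Y \<or> Y \<subseteq> X \<Longrightarrow> p X \<noteq> p (uminus ` Y)"
    and AB: "A \<union> B = {..Suc e}" "A \<inter> B = {}" "A \<noteq> {}" "0 \<in> B"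
  obtains X where "X \<in> two_sided r (r + e)"
    "A \<subseteq> p ` {Y \<in> two_sided r (r + e). Y \<subseteq> X}"
    "B \<subseteq> (\<lambda>Y. p (uminus ` Y)) ` {Y \<in> two_sided r (r + e). Y \<subseteq> X}"
proof -
  let ?q = "\<lambda>X. p (uminus ` X)"
  let ?T = "two_sided r (r + e)"
  have ne': "p (y i) \<noteq> ?q (y j)" if "y \<in> sign_chains r e" "i \<le> e" "j \<le> e" for y i j
    using ne[of "y i" "y j"] sign_chains_two_sided[OF that(1)] sign_chains_mono[OF that(1)] that(2,3) by (meson linear)
  have col': "p (y i) \<le> Suc e \<and> ?q (y i) \<le> Suc e" if "y \<in> sign_chains r e" "i \<le> e" for y i
    using sign_chains_two_sided[OF that] two_sided_uminus col by blast
  have base: "split_chains r e p ?q {1..Suc e} {0} = 1"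
  proof -
    have "split_chains r e p ?q {1..Suc e} {0} =
        (\<Sum>y\<in>sign_chains r e. of_bool (alt_seq 0 (Suc e) (max_sign p \<circ> y)))"
      unfolding split_chains_def
    proof (rule sum.cong[OF refl])
      fix y assume y: "y \<in> sign_chains r e"
      show "of_bool ((\<lambda>i. p (y i)) ` {..<card {1..Suc e}} = {1..Suc e}) *
          of_bool ((\<lambda>i. ?q (y i)) ` {card {1..Suc e} - 1..e} = {0}) =
          (of_bool (alt_seq 0 (Suc e) (max_sign p \<circ> y)) :: bit)"
        using alternating_max_sign_iff[OF y refl col mono ne'[OF y]]
        by (simp only: card_atLeastAtMost diff_Suc_1 lessThan_Suc_atMost flip: of_bool_conj)
    qed
    also have "\<dots> = 1"
    proof (rule sum_alternating_chains[OF r])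
      fix X assume X: "X \<in> ?T"
      have n: "p X \<noteq> ?q X" using ne[OF X X] by simp
      have i: "uminus ` uminus ` X = X" by (simp add: image_image)
      have *: "x + 1 + of_bool (\<not> P) = x + 1 + of_bool P + (1::bit)" for x P
        by (cases x; cases P) simp_all
      have "?q X < p X \<longleftrightarrow> \<not> p X < ?q X" using n by auto
      then show "max_sign p (uminus ` X) = max_sign p X + 1"
        unfolding max_sign_def i by (simp only: max.commute *)
    qed
    finally show ?thesis .
  qed
  have finB: "finite B" using AB(1) by (metis finite_Un finite_atMost)
  \<comment> \<open>The first part varies in the induction, because undoing the move of
    \<open>b\<close> enlarges it.\<close>
  have "\<forall>A. A \<union> insert 0 C = {..Suc e} \<longrightarrow> A \<inter> insert 0 C = {} \<longrightarrow> A \<noteq> {} \<longrightarrow>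
      split_chains r e p ?q A (insert 0 C) = 1" if "finite C" "0 \<notin> C" for C
    using that
  proof (induction C rule: finite_induct)
    case empty
    have "A = {1..Suc e}" if "A \<union> {0} = {..Suc e}" "A \<inter> {0} = {}" for A
    proof -
      have "A = {..Suc e} - {0}" using that by blast
      then show ?thesis by auto
    qed
    then show ?case using base by auto
  next
    case (insert b C)
    show ?case
    proof (intro allI impI)
      fix A assume A: "A \<union> insert 0 (insert b C) = {..Suc e}" "A \<inter> insert 0 (insert b C) = {}" "A \<noteq> {}"
      have "split_chains r e p ?q A (insert b (insert 0 C)) = split_chains r e p ?q (insert b A) (insert 0 C)"
      proof (rule split_chains_move[of r e p ?q A "insert 0 C" b, symmetric])
        show "insert b (A \<union> insert 0 C) = {..Suc e}" using A(1) by blast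
      qed (use r A insert.hyps insert.prems in \<open>simp_all add: col' ne'\<close>)
      also have "\<dots> = 1" using insert A by auto
      finally show "split_chains r e p ?q A (insert 0 (insert b C)) = 1" by (simp add: insert_commute)
    qed
  qed
  from this[of "B - {0}"] have one: "split_chains r e p ?q A B = 1"
    using AB finB by (simp add: insert_absorb)
  have "\<exists>y\<in>sign_chains r e. (\<lambda>i. p (y i)) ` {..<card A} = A \<and> (\<lambda>i. ?q (y i)) ` {card A - 1..e} = B"
  proof (rule ccontr)
    assume "\<not> ?thesis"
    then have "split_chains r e p ?q A B = 0"
      unfolding split_chains_def by (intro sum.neutral) auto
    then show False using one by simp
  qed
  then obtain y where y: "y \<in> sign_chains r e" "(\<lambda>i. p (y i)) ` {..<card A} = A" "(\<lambda>i. ?q (y i)) ` {card A - 1..e} = B"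
    by blast
  have finA: "finite A" using AB(1) by (metis finite_Un finite_atMost)
  have "card A + card B = Suc (Suc e)"
    using card_Un_disjoint[OF finA finB AB(2)] AB(1) by simp
  moreover have "card B > 0" using finB AB(4) by (auto simp: card_gt_0_iff)
  ultimately have "card A \<le> Suc e" by simp
  then have sub: "y i \<in> {Y \<in> ?T. Y \<subseteq> y e}" if "i < card A \<or> i \<le> e" for i
  proof -
    have "i \<le> e" using that \<open>card A \<le> Suc e\<close> by linarith
    then show ?thesis using sign_chains_two_sided[OF y(1)] sign_chains_mono[OF y(1), of i e] by simp
  qed
  show ?thesis
  proof
    show "y e \<in> ?T" by (rule sign_chains_two_sided[OF y(1)]) simp
    have "(\<lambda>i. p (y i)) ` {..<card A} \<subseteq> p ` {Y \<in> ?T. Y \<subseteq> y e}"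
      using sub by (intro image_subsetI imageI) simp
    then show "A \<subseteq> p ` {Y \<in> ?T. Y \<subseteq> y e}" unfolding y(2) .
    have "(\<lambda>i. ?q (y i)) ` {card A - 1..e} \<subseteq> ?q ` {Y \<in> ?T. Y \<subseteq> y e}"
      using sub by (intro image_subsetI imageI) simp
    then show "B \<subseteq> ?q ` {Y \<in> ?T. Y \<subseteq> y e}" unfolding y(3) .
  qed
qed

section \<open>Stable subsets of 2-stable sets\<close>

text \<open>The function \<open>f\<close> enumerates a periodic set. If greedy selection with step at least \<open>2 * h\<close> always
  failed to fit \<open>k\<close> steps into one period, a periodic greedy orbit with \<open>a\<close> steps and \<open>b\<close> turns would
  satisfy \<open>a < b * k\<close>. Each gap of the set is overshot at most once by such an orbit, which bounds
  \<open>b * n\<close> by \<open>a * (2 * h + 1) + n - 2 * K\<close> and contradicts the lower bound on \<open>n\<close>.\<close>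

lemma stable_greedy:
  fixes f :: "nat \<Rightarrow> nat" and h K n k :: nat
  assumes h: "h > 0" and k: "k > 1" and K: "K = h * (k - 1) + 1" and n: "n \<ge> (2 * h + 2) * k - 2"
    and gap: "\<And>j. f j + 2 \<le> f (Suc j)" and per: "\<And>j. f (j + K) = f j + n"
  obtains u where "\<And>i. Suc i < k \<Longrightarrow> u i < u (Suc i) \<and> f (u i) + 2 * h \<le> f (u (Suc i))"
    "f (u (k - 1)) + 2 * h \<le> f (u 0) + n"
proof (rule ccontr)
  assume notthesis: "\<not> thesis"
  have K0: "K > 0" using K by simp
  have mono2: "f i + 2 * d \<le> f (i + d)" for i d
  proof (induction d)
    case (Suc d) then show ?case using gap[of "i + d"] by simp
  qed simp
  have strict: "f i < f j \<longleftrightarrow> i < j" for i j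
  proof -
    have "f a < f b" if "a < b" for a b
      using mono2[of a "b - a"] that by simp
    then show ?thesis by (metis linorder_neqE_nat order_less_asym less_irrefl)
  qed
  have lef: "f i \<le> f j \<longleftrightarrow> i \<le> j" for i j using strict[of j i] by (simp add: not_less flip: not_less)
  define \<psi> where "\<psi> j = (LEAST m. f j + 2 * h \<le> f m)" for j
  have \<psi>1: "f j + 2 * h \<le> f (\<psi> j)" for j
    unfolding \<psi>_def by (rule LeastI[of _ "j + h"]) (rule mono2)
  have \<psi>2: "\<psi> j \<le> j + h" for j
    unfolding \<psi>_def by (rule Least_le) (rule mono2)
  have \<psi>3: "j < \<psi> j" for j using \<psi>1[of j] h strict[of j "\<psi> j"] by linarith
  have \<psi>4: "f (\<psi> j - 1) + 1 \<le> f j + 2 * h" for j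
    using not_less_Least[of "\<psi> j - 1" "\<lambda>m. f j + 2 * h \<le> f m"] \<psi>3[of j] unfolding \<psi>_def[symmetric] by auto
  define v where "v i = (\<psi> ^^ i) 0" for i
  have vS: "v (Suc i) = \<psi> (v i)" for i by (simp add: v_def)
  have vmono: "v i < v j" if "i < j" for i j
    using that by (rule lift_Suc_mono_less[rotated]) (simp add: vS \<psi>3)
  \<comment> \<open>If \<open>k\<close> steps fit into one period, the \<open>k\<close> points
    visited before the last landing form a valid \<open>u\<close>.\<close>
  have fail: "v i + K < v (i + k)" for i
  proof (rule ccontr)
    assume "\<not> v i + K < v (i + k)"
    then have "f (v (i + k)) \<le> f (v i) + n" unfolding per[symmetric] lef by simp
    moreover have "f (v (i + (k - 1))) + 2 * h \<le> f (v (i + k))"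
      using \<psi>1[of "v (i + (k - 1))"] k vS[of "i + (k - 1)"] by (simp del: One_nat_def)
    ultimately have "f (v (i + (k - 1))) + 2 * h \<le> f (v i) + n" by simp
    moreover have "v (i + j) < v (i + Suc j) \<and> f (v (i + j)) + 2 * h \<le> f (v (i + Suc j))" for j
      using vmono[of "i + j" "i + Suc j"] \<psi>1[of "v (i + j)"] vS[of "i + j"] by simp
    ultimately show False using notthesis that[of "\<lambda>j. v (i + j)"] by simp
  qed
  have fails: "v i + b * K + b \<le> v (i + b * k)" for i b
  proof (induction b)
    case (Suc b) then show ?case using fail[of "i + b * k"] by (simp add: algebra_simps)
  qed simp
  have "\<exists>i j. i < j \<and> v i mod K = v j mod K"
  proof (rule ccontr)
    assume "\<not> (\<exists>i j. i < j \<and> v i mod K = v j mod K)"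
    then have "inj (\<lambda>i. v i mod K)" by (intro linorder_injI) blast
    moreover have "finite (range (\<lambda>i. v i mod K))"
      by (rule finite_subset[of _ "{..<K}"]) (use K0 in auto)
    ultimately show False using finite_imageD infinite_UNIV_nat by blast
  qed
  \<comment> \<open>The earliest repetition is chosen so that the residues of \<open>v\<close> at
    the indices from \<open>i0 + 1\<close> to \<open>a0\<close> are pairwise distinct.\<close>
  then obtain i0 a0 where ij: "i0 < a0" "v i0 mod K = v a0 mod K"
    and least: "\<And>i j. i < j \<Longrightarrow> j < a0 \<Longrightarrow> v i mod K \<noteq> v j mod K"
  proof -
    let ?P = "\<lambda>j. \<exists>i<j. v i mod K = v j mod K"
    assume "\<exists>i j. i < j \<and> v i mod K = v j mod K"
    then have ex: "\<exists>j. ?P j" by blast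
    have "?P (LEAST j. ?P j)" using ex by (rule LeastI_ex)
    moreover have "\<And>i j. i < j \<Longrightarrow> j < (LEAST j. ?P j) \<Longrightarrow> v i mod K \<noteq> v j mod K"
      using not_less_Least by blast
    ultimately show ?thesis using that by blast
  qed
  define a where "a = a0 - i0"
  have a: "a > 0" "a0 = i0 + a" using ij by (auto simp: a_def)
  obtain b where b: "v (i0 + a) = v i0 + b * K"
    using ij a vmono[of i0 a0] by (metis less_imp_le mod_eq_nat1E mult.commute)
  have b0: "b > 0" using b vmono[of i0 "i0 + a"] a by (cases b) auto
  have perb: "f (v i0 + b * K) = f (v i0) + b * n"
  proof (induction b)
    case (Suc b) then show ?case using per[of "v i0 + b * K"] by (simp add: algebra_simps)
  qed simp
  \<comment> \<open>Every \<open>k\<close> steps make more than one turn, so \<open>b * k\<close>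
    steps make more than \<open>b\<close> turns, while \<open>a\<close> steps make exactly
    \<open>b\<close>.\<close>
  have abk: "a < b * k"
  proof (rule ccontr)
    assume "\<not> a < b * k"
    then have "v (i0 + b * k) \<le> v (i0 + a)"
      using vmono[of "i0 + b * k" "i0 + a"] by (cases "a = b * k") auto
    then show False using fails[of i0 b] b b0 by simp
  qed
  have "v (i0 + d) \<le> v i0 + d * h" for d
  proof (induction d)
    case (Suc d) then show ?case using \<psi>2[of "v (i0 + d)"] vS[of "i0 + d"] by simp
  qed simp
  from this[of a] have bK: "b * K \<le> a * h" using b by simp
  define G where "G j = f (Suc j) - f j" for j
  have G2: "G j \<ge> 2" for j using gap[of j] by (simp add: G_def)
  have Gper: "G (j mod K) = G j" for j
  proof -
    have p: "f (i + q * K) = f i + q * n" for i q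
    proof (induction q)
      case (Suc q) then show ?case using per[of "i + q * K"] by (simp add: algebra_simps)
    qed simp
    have "f (j mod K + (j div K) * K) = f (j mod K) + (j div K) * n"
      "f (Suc (j mod K) + (j div K) * K) = f (Suc (j mod K)) + (j div K) * n" by (rule p)+
    then show ?thesis unfolding G_def by simp
  qed
  \<comment> \<open>A step stops at the first admissible index, so it exceeds \<open>2 * h\<close>
    by less than the gap just before its landing point.\<close>
  have step: "f (v (Suc i)) + 1 \<le> f (v i) + 2 * h + G (v (Suc i) - 1)" for i
  proof -
    have "f (v (Suc i)) = f (v (Suc i) - 1) + G (v (Suc i) - 1)"
      using \<psi>3[of "v i"] gap[of "v (Suc i) - 1"] by (simp add: G_def vS)
    then show ?thesis using \<psi>4[of "v i"] by (simp add: vS)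
  qed
  have "f (v (i0 + d)) + d \<le> f (v i0) + d * (2 * h) + (\<Sum>i<d. G (v (Suc (i0 + i)) - 1))" for d
  proof (induction d)
    case (Suc d) then show ?case using step[of "i0 + d"] by (simp add: algebra_simps)
  qed simp
  from this[of a] have tot: "b * n + a \<le> a * (2 * h) + (\<Sum>i<a. G (v (Suc (i0 + i)) - 1))"
    unfolding b perb by simp
  \<comment> \<open>Residues of the gaps just before the landing points. They are distinct, so these
    gaps sum to at most one period, and each of the \<open>K - a\<close> remaining gaps takes at
    least 2 of it.\<close>
  define R where "R i = (v (Suc (i0 + i)) - 1) mod K" for i
  have injR: "inj_on R {..<a}"
  proof (rule linorder_inj_onI)
    fix i j assume ij': "i < j" "i \<in> {..<a}" "j \<in> {..<a}"
    show "R i \<noteq> R j"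
    proof
      assume "R i = R j"
      moreover have pos: "v (Suc m) > 0" for m using vmono[of m "Suc m"] by simp
      ultimately have "(v (Suc (i0 + i)) - 1 + 1) mod K = (v (Suc (i0 + j)) - 1 + 1) mod K"
        unfolding R_def by (metis mod_add_left_eq)
      then have eq: "v (Suc (i0 + i)) mod K = v (Suc (i0 + j)) mod K"
        using pos[of "i0 + i"] pos[of "i0 + j"] by simp
      show False
      proof (cases "Suc (i0 + j) < a0")
        case True
        then show False using least[of "Suc (i0 + i)" "Suc (i0 + j)"] eq ij' by simp
      next
        case False
        then have "Suc (i0 + j) = a0" using ij' a by simp
        then have "v (Suc (i0 + i)) mod K = v i0 mod K" using eq ij by simp
        then show False using least[of i0 "Suc (i0 + i)"] ij' a \<open>Suc (i0 + j) = a0\<close> by simp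
      qed
    qed
  qed auto
  have RK: "R ` {..<a} \<subseteq> {..<K}" using K0 by (auto simp: R_def)
  have cardR: "card (R ` {..<a}) = a" using injR by (simp add: card_image)
  then have aK: "a \<le> K" using card_mono[OF finite_lessThan RK] by simp
  have sumR: "(\<Sum>i<a. G (v (Suc (i0 + i)) - 1)) = (\<Sum>j\<in>R ` {..<a}. G j)"
    unfolding sum.reindex[OF injR] by (simp add: R_def Gper)
  have "(\<Sum>j<K. G j) = n"
  proof -
    have "f d = f 0 + (\<Sum>j<d. G j)" for d
    proof (induction d)
      case (Suc d) then show ?case using gap[of d] by (simp add: G_def)
    qed simp
    from this[of K] per[of 0] show ?thesis by simp
  qed
  moreover have "(\<Sum>j<K. G j) = (\<Sum>j\<in>{..<K} - R ` {..<a}. G j) + (\<Sum>j\<in>R ` {..<a}. G j)"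
    by (rule sum.subset_diff[OF RK]) simp
  moreover have "2 * (K - a) \<le> (\<Sum>j\<in>{..<K} - R ` {..<a}. G j)"
  proof -
    have "(\<Sum>j\<in>{..<K} - R ` {..<a}. 2) \<le> (\<Sum>j\<in>{..<K} - R ` {..<a}. G j)"
      by (rule sum_mono) (rule G2)
    moreover have "card ({..<K} - R ` {..<a}) = K - a"
      using card_Diff_subset[OF _ RK] cardR by simp
    ultimately show ?thesis by simp
  qed
  ultimately have "(\<Sum>i<a. G (v (Suc (i0 + i)) - 1)) + 2 * (K - a) \<le> n" using sumR by simp
  then have main: "b * n + a + 2 * K \<le> a * (2 * h) + n + 2 * a" using tot aK by simp
  \<comment> \<open>A single turn is impossible: it advances \<open>K = h * (k - 1) + 1\<close>
    indices, but fewer than \<open>k\<close> steps of at most \<open>h\<close> indices each are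
    available.\<close>
  have b2: "b \<ge> 2"
  proof (rule ccontr)
    assume "\<not> b \<ge> 2"
    then have "b = 1" using b0 by simp
    then have "(k - 1) * h + 1 \<le> a * h" "a \<le> k - 1" using bK abk K by (simp_all add: mult.commute)
    moreover have "a * h \<le> (k - 1) * h" using \<open>a \<le> k - 1\<close> by (rule mult_le_mono1)
    ultimately show False by linarith
  qed
  obtain k' \<beta> where k': "k = k' + 2" "b = \<beta> + 2"
    using k b2 by (metis Suc_1 Suc_leI add.commute le_Suc_ex)
  have "(\<beta> + 2) * n = (\<beta> + 1) * n + n" "a * (2 * h + 1) = a * (2 * h) + a"
    by (simp_all add: algebra_simps)
  with main have 1: "(\<beta> + 1) * n + 2 * K \<le> a * (2 * h + 1)" unfolding k'(2) by linarith
  have "(2 * h + 2) * k - 2 = 2 * h * k' + 4 * h + 2 * k' + 2" unfolding k' by (simp add: algebra_simps)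
  then have 2: "(\<beta> + 1) * (2 * h * k' + 4 * h + 2 * k' + 2) \<le> (\<beta> + 1) * n"
    using n by (intro mult_le_mono2) simp
  have "b * k = \<beta> * k' + 2 * \<beta> + 2 * k' + 4" unfolding k' by (simp add: algebra_simps)
  then have 3: "a * (2 * h + 1) \<le> (\<beta> * k' + 2 * \<beta> + 2 * k' + 3) * (2 * h + 1)"
    using abk by (intro mult_le_mono1) simp
  have 4: "K = h * k' + h + 1" using k' K by (simp add: algebra_simps)
  \<comment> \<open>The margin is \<open>\<beta> * k' + 1\<close>. For two turns,
    \<open>\<beta> = 0\<close>, it is 1, so this comparison uses the lower bound on \<open>n\<close>
    with nothing to spare.\<close>
  have "(\<beta> + 1) * (2 * h * k' + 4 * h + 2 * k' + 2) + 2 * (h * k' + h + 1) =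
      (\<beta> * k' + 2 * \<beta> + 2 * k' + 3) * (2 * h + 1) + \<beta> * k' + 1"
    by (simp add: algebra_simps)
  then show False using 1 2 3 unfolding 4 by linarith
qed

text \<open>Unrolling the cycle of length \<open>n\<close> into a periodic increasing sequence turns
  the upper bound on distances into a gap across the end of a period, so that
  \<open>stable_greedy\<close> can work with one-sided gaps.\<close>

lemma s_stable_subset_of_2_stable:
  assumes P: "s_stable 2 n P" "card P = h * (k - 1) + 1" and h: "h > 0" and k: "k > 0"
    and n: "n \<ge> (2 * h + 2) * k - 2"
  obtains S where "S \<subseteq> P" "s_stable (2 * h) n S" "card S = k"
proof (cases "k = 1")
  case True
  obtain x where "x \<in> P" "x \<in> {1..n}" using P(1) unfolding s_stable_def by blast
  then show ?thesis using that[of "{x}"] True by (auto simp: s_stable_def)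
next
  case False
  then have k1: "k > 1" using k by simp
  define K where "K = h * (k - 1) + 1"
  have K: "K \<ge> 2" using h k1 by (simp add: K_def Suc_le_eq)
  have Pn: "P \<subseteq> {1..n}" using P(1) by (simp add: s_stable_def)
  then have finP: "finite P" using finite_subset by blast
  define ps where "ps = sorted_list_of_set P"
  have len: "length ps = K" using P(2) by (simp add: ps_def K_def)
  have inP: "ps ! i \<in> P" if "i < K" for i
    using that nth_mem[of i ps] len finP by (simp add: ps_def)
  have less: "ps ! i < ps ! j" if "i < j" "j < K" for i j
    using that len strict_sorted_list_of_set[of P] unfolding ps_def by (simp add: sorted_wrt_nth_less)
  have st: "ps ! i + 2 \<le> ps ! j" "ps ! j + 2 \<le> ps ! i + n" if "i < j" "j < K" for i j
  proof -
    have a: "ps ! i \<in> P" "ps ! j \<in> P" "ps ! i < ps ! j" "ps ! i \<noteq> ps ! j"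
      using inP[of i] inP[of j] less[OF that] that by auto
    have "int 2 \<le> \<bar>int (ps ! i) - int (ps ! j)\<bar> \<and> \<bar>int (ps ! i) - int (ps ! j)\<bar> \<le> int n - int 2"
      using P(1) a unfolding s_stable_def by blast
    then show "ps ! i + 2 \<le> ps ! j" "ps ! j + 2 \<le> ps ! i + n" using a(3) by linarith+
  qed
  define f where "f j = ps ! (j mod K) + n * (j div K)" for j
  have per: "f (j + K) = f j + n" for j using K by (simp add: f_def)
  have gap: "f j + 2 \<le> f (Suc j)" for j
  proof (cases "Suc (j mod K) = K")
    case True
    have "Suc j mod K = 0" "Suc j div K = Suc (j div K)"
      using True by (simp_all add: mod_Suc div_Suc)
    moreover have "ps ! (j mod K) + 2 \<le> ps ! 0 + n" using st(2)[of 0 "j mod K"] True K by simp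
    ultimately show ?thesis by (simp add: f_def)
  next
    case False
    then have "Suc j mod K = Suc (j mod K)" "Suc j div K = j div K"
      by (simp_all add: mod_Suc div_Suc)
    moreover have "Suc (j mod K) < K" using False K by (metis Suc_lessI mod_less_divisor not_numeral_le_zero not_gr_zero)
    ultimately show ?thesis using st(1)[of "j mod K" "Suc (j mod K)"] by (simp add: f_def)
  qed
  obtain u where u: "\<And>i. Suc i < k \<Longrightarrow> u i < u (Suc i) \<and> f (u i) + 2 * h \<le> f (u (Suc i))"
    "f (u (k - 1)) + 2 * h \<le> f (u 0) + n"
    using stable_greedy[OF h k1 K_def n gap per] by blast
  have um: "f (u i) + 2 * h \<le> f (u j)" if "i < j" "j < k" for i j
    using that
  proof (induction j)
    case (Suc j)
    then show ?case using u(1)[of j] by (cases "i = j") auto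
  qed simp
  have um': "f (u i) \<le> f (u j)" if "i \<le> j" "j < k" for i j
    using um[of i j] that by (cases "i = j") auto
  define x where "x i = ps ! (u i mod K)" for i
  have xP: "x i \<in> P" for i unfolding x_def using inP K by simp
  have D: "int (2 * h) \<le> \<bar>int (x i) - int (x j)\<bar> \<and> \<bar>int (x i) - int (x j)\<bar> \<le> int n - int (2 * h)"
    if ij: "i < j" "j < k" for i j
  proof -
    \<comment> \<open>The number of turns between the two chosen points. It is 0 or 1, as they are
      less than one period apart in the lift; if it is 1, the order of \<open>x i\<close> and
      \<open>x j\<close> is reversed.\<close>
    define d where "d = int (u j div K) - int (u i div K)"
    have lo: "f (u i) + 2 * h \<le> f (u j)" using um ij by simp
    have "f (u j) \<le> f (u (k - 1))" "f (u 0) \<le> f (u i)" using um' ij by auto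
    then have hi: "f (u j) + 2 * h \<le> f (u i) + n" using u(2) by linarith
    have "int (f (u j)) - int (f (u i)) = int (x j) - int (x i) + int n * d"
      by (simp add: f_def x_def d_def algebra_simps)
    then have e: "int (2 * h) \<le> int (x j) - int (x i) + int n * d"
      "int (x j) - int (x i) + int n * d \<le> int n - int (2 * h)" using lo hi by linarith+
    have b: "1 \<le> x i" "x i \<le> n" "1 \<le> x j" "x j \<le> n" using xP Pn by (meson atLeastAtMost_iff subsetD)+
    have "d \<ge> 0"
    proof (rule ccontr)
      assume "\<not> d \<ge> 0"
      then have "int n * d \<le> int n * (- 1)" by (intro mult_left_mono) auto
      then show False using e(1) b h by linarith
    qed
    moreover have "d \<le> 1"
    proof (rule ccontr)
      assume "\<not> d \<le> 1"
      then have "int n * 2 \<le> int n * d" by (intro mult_left_mono) auto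
      then show False using e(2) b h by linarith
    qed
    ultimately consider "d = 0" | "d = 1" by linarith
    then show ?thesis by cases (use e h in auto)
  qed
  have inj: "inj_on x {..<k}"
    by (rule linorder_inj_onI) (use D h in fastforce)+
  show ?thesis
  proof
    show "x ` {..<k} \<subseteq> P" using xP by blast
    show "card (x ` {..<k}) = k" using inj by (simp add: card_image)
    show "s_stable (2 * h) n (x ` {..<k})"
      unfolding s_stable_def
    proof (intro conjI ballI impI)
      show "x ` {..<k} \<noteq> {}" using k by auto
      show "x ` {..<k} \<subseteq> {1..n}" using xP Pn by blast
      fix a b assume "a \<in> x ` {..<k}" "b \<in> x ` {..<k}" "a \<noteq> b"
      then obtain i j where "a = x i" "b = x j" "i < k" "j < k" "i \<noteq> j" by blast
      then show "int (2 * h) \<le> \<bar>int a - int b\<bar>" "\<bar>int a - int b\<bar> \<le> int n - int (2 * h)"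
        using D[of i j] D[of j i] by (metis abs_minus_commute linorder_neqE_nat)+
    qed
  qed
qed

section \<open>Colorful complete bipartite subgraphs\<close>

definition pos_part :: "int set \<Rightarrow> nat set" where
  "pos_part X = {i. int i \<in> X}"

lemma pos_part_mono: "X \<subseteq> Y \<Longrightarrow> pos_part X \<subseteq> pos_part Y"
  unfolding pos_part_def by blast

lemma pos_part_disjoint:
  assumes "X \<in> signed n" "Y \<in> signed n" "X \<subseteq> Y \<or> Y \<subseteq> X"
  shows "pos_part X \<inter> pos_part (uminus ` Y) = {}"
  using assms unfolding pos_part_def signed_def by auto

text \<open>Consecutive positive entries have a negative one between them; as the length is even,
  this also holds across the end of the cycle.\<close>

lemma alternating_pos_part_2_stable:
  assumes v: "v \<in> signed n" "alternating b v" "card v = 2 * K" and K: "K > 0"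
  shows "s_stable 2 n (pos_part v)" "card (pos_part v) = K"
proof -
  obtain f where bij: "bij_betw f {..<card v} v"
    and ord: "\<And>i j. i < card v \<Longrightarrow> j < card v \<Longrightarrow> \<bar>f i\<bar> < \<bar>f j\<bar> \<longleftrightarrow> i < j"
    using signed_enum[OF v(1)] by metis
  \<comment> \<open>Index of the first positive entry; the positive entries are those with index
    \<open>2 * i + c\<close>.\<close>
  define c :: nat where "c = (if b = 0 then 0 else 1)"
  have c: "c \<le> 1" by (simp add: c_def)
  have fv: "f i \<in> v" if "i < 2 * K" for i using bij that v(3) by (auto simp: bij_betw_def)
  have rng: "\<bar>f i\<bar> \<in> {1..int n}" if "i < 2 * K" for i
    using signed_abs_range[OF v(1)] fv[OF that] by blast
  have "alt_seq b (card v) (\<lambda>i. of_bool (f i < 0))"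
    using alternating_iff_alt_seq[OF bij ord] v(2) by blast
  then have sign: "of_bool (f i < 0) = b + of_nat i" if "i < 2 * K" for i
    using that v(3) by (simp only: alt_seq_def)
  then have neg: "f i < 0 \<longleftrightarrow> odd (i + c)" if "i < 2 * K" for i
    using sign[OF that] of_nat_bit_eq_0_iff[of i]
    by (cases "f i < 0"; cases b; cases "of_nat i :: bit") (simp_all add: c_def)
  have pos: "f (2 * i + c) > 0" if "i < K" for i
  proof -
    have l: "2 * i + c < 2 * K" using that c by simp
    have "\<not> f (2 * i + c) < 0" using neg[OF l] by simp
    then show ?thesis using rng[OF l] by auto
  qed
  define g where "g i = nat (f (2 * i + c))" for i
  have g: "int (g i) = f (2 * i + c)" "int (g i) = \<bar>f (2 * i + c)\<bar>" if "i < K" for i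
    using pos[OF that] by (simp_all add: g_def)
  have img: "pos_part v = g ` {..<K}"
  proof (intro equalityI subsetI)
    fix x assume "x \<in> pos_part v"
    then have x: "int x \<in> v" by (simp add: pos_part_def)
    then obtain i where i: "i < 2 * K" "f i = int x" using bij v(3) unfolding bij_betw_def by force
    have "even (i + c)" using neg[OF i(1)] i(2) by simp
    then have "2 * (i div 2) + c = i" using c by (cases "c = 0") (auto simp: le_Suc_eq elim!: oddE)
    then have "x = g (i div 2)" using i(2) by (simp add: g_def)
    moreover have "i div 2 < K" using i(1) by auto
    ultimately show "x \<in> g ` {..<K}" by blast
  next
    fix x assume "x \<in> g ` {..<K}"
    then obtain i where i: "i < K" "x = g i" by blast
    have "2 * i + c < 2 * K" using i c by simp
    then show "x \<in> pos_part v" using fv g(1)[OF i(1)] i by (simp add: pos_part_def)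
  qed
  have D: "2 \<le> int (g j) - int (g i) \<and> int (g j) - int (g i) \<le> int n - 2" if ij: "i < j" "j < K" for i j
  proof -
    have l: "2 * i + c < 2 * K" "2 * i + c + 1 < 2 * K" "2 * j + c < 2 * K" using ij c by auto
    have "\<bar>f (2 * i + c)\<bar> < \<bar>f (2 * i + c + 1)\<bar>" "\<bar>f (2 * i + c + 1)\<bar> < \<bar>f (2 * j + c)\<bar>"
      using ord[of "2 * i + c" "2 * i + c + 1"] ord[of "2 * i + c + 1" "2 * j + c"] l v(3) ij by auto
    then have 1: "2 \<le> int (g j) - int (g i)" using g ij by simp
    have r: "1 \<le> \<bar>f (2 * i + c)\<bar>" "\<bar>f (2 * j + c)\<bar> \<le> int n" using rng l by auto
    \<comment> \<open>If the vector starts with \<open>+\<close>, its last entry is negative and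
      lies beyond \<open>g j\<close>; otherwise its first entry is negative and lies before
      \<open>g i\<close>. Either way one more position is lost.\<close>
    have "int (g j) - int (g i) \<le> int n - 2"
    proof (cases "c = 0")
      case True
      then have "2 * j + c + 1 < 2 * K" using ij by simp
      then have "\<bar>f (2 * j + c)\<bar> < \<bar>f (2 * j + c + 1)\<bar>" "\<bar>f (2 * j + c + 1)\<bar> \<le> int n"
        using ord[of "2 * j + c" "2 * j + c + 1"] rng[of "2 * j + c + 1"] v(3) by auto
      then show ?thesis using g(2)[of i] g(2)[of j] ij r by simp
    next
      case False
      then have "\<bar>f 0\<bar> < \<bar>f (2 * i + c)\<bar>" "1 \<le> \<bar>f 0\<bar>"
        using ord[of 0 "2 * i + c"] rng[of 0] v(3) l K by auto
      then show ?thesis using g(2)[of i] g(2)[of j] ij r by simp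
    qed
    with 1 show ?thesis by simp
  qed
  have "inj_on g {..<K}"
    by (rule linorder_inj_onI) (use D in fastforce)+
  then show "card (pos_part v) = K" unfolding img by (simp add: card_image)
  show "s_stable 2 n (pos_part v)"
    unfolding s_stable_def img
  proof (intro conjI ballI impI)
    show "g ` {..<K} \<noteq> {}" using K by auto
    show "g ` {..<K} \<subseteq> {1..n}"
    proof
      fix x assume "x \<in> g ` {..<K}"
      then obtain i where i: "i < K" "x = g i" by blast
      have "2 * i + c < 2 * K" using i c by simp
      then show "x \<in> {1..n}" using rng[of "2 * i + c"] g(2)[OF i(1)] i(2) by auto
    qed
    fix x y assume "x \<in> g ` {..<K}" "y \<in> g ` {..<K}" "x \<noteq> y"
    then obtain i j where ij: "x = g i" "y = g j" "i < K" "j < K" "i \<noteq> j" by blast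
    consider "i < j" | "j < i" using ij(5) by linarith
    then show "int 2 \<le> \<bar>int x - int y\<bar>" "\<bar>int x - int y\<bar> \<le> int n - int 2"
      using D[of i j] D[of j i] ij by (cases; simp)+
  qed
qed

lemma stable_set_in_two_sided:
  assumes X: "X \<in> two_sided (2 * (h * (k - 1) + 1)) n" and h: "h > 0" and k: "k > 0"
    and n: "n \<ge> (2 * h + 2) * k - 2"
  obtains S where "S \<subseteq> pos_part X" "s_stable (2 * h) n S" "card S = k"
proof -
  obtain b v where v: "X \<in> signed n" "v \<subseteq> X" "alternating b v" "card v = 2 * (h * (k - 1) + 1)"
    using X unfolding two_sided_def by blast
  have "v \<in> signed n" using signed_subset v(1,2) .
  note s = alternating_pos_part_2_stable[OF this v(3,4)]
  show ?thesis
  proof (rule s_stable_subset_of_2_stable[OF s _ _ n])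
    fix S assume "S \<subseteq> pos_part v" "s_stable (2 * h) n S" "card S = k"
    then show ?thesis using that pos_part_mono[OF v(2)] by blast
  qed (use h k in simp_all)
qed

text \<open>The label \<open>p\<close> is the largest renumbered colour among the stable sets in
  \<open>pos_part X\<close>. The sets \<open>P\<close> and \<open>Q\<close> are the two sides of the
  vector supplied by \<open>exists_split_chain\<close>.\<close>

lemma colorful_disjoint_sets:
  fixes c :: "nat set \<Rightarrow> nat"
  assumes h: "h > 0" and k: "k > 0" and n: "n \<ge> (2 * h + 2) * k - 2"
    and V: "V = {S. s_stable (2 * h) n S \<and> card S = k}"
    and c: "\<And>S. S \<in> V \<Longrightarrow> c S \<in> {1..n - 2 * h * (k - 1)}"
    and proper: "\<And>S T. S \<in> V \<Longrightarrow> T \<in> V \<Longrightarrow> S \<inter> T = {} \<Longrightarrow> c S \<noteq> c T"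
    and AB: "A \<union> B = {1..n - 2 * h * (k - 1)}" "A \<inter> B = {}" "A \<noteq> {}" "B \<noteq> {}"
  obtains P Q where "P \<inter> Q = {}" "\<And>a. a \<in> A \<Longrightarrow> \<exists>S\<in>V. S \<subseteq> P \<and> c S = a"
    "\<And>b. b \<in> B \<Longrightarrow> \<exists>S\<in>V. S \<subseteq> Q \<and> c S = b"
proof -
  define r where "r = 2 * (h * (k - 1) + 1)"
  define t where "t = n - 2 * h * (k - 1)"
  obtain k' where k': "k = Suc k'" using k by (cases k) auto
  have "n \<ge> 2 * h * k' + 2 * h + 2 * k'" using n unfolding k' by (simp add: algebra_simps)
  then have rn: "r \<le> n" "t = Suc (Suc (n - r))" using h by (auto simp: r_def t_def k' algebra_simps)
  define e where "e = n - r"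
  have ne: "n = r + e" "t = Suc (Suc e)" using rn by (auto simp: e_def)
  obtain b0 where b0: "b0 \<in> B" using AB(4) by blast
  have b0t: "b0 \<in> {1..t}" using b0 AB(1) unfolding t_def by blast
  \<comment> \<open>The split argument keeps 0 on the negative side throughout, so 0 is given to a
    colour of \<open>B\<close>.\<close>
  obtain \<rho> where \<rho>: "bij_betw \<rho> {1..t} {..Suc e}" "\<rho> b0 = 0"
  proof -
    have "card ({1..t} - {b0}) = card {1..Suc e}" using b0t ne by simp
    then obtain g where g: "bij_betw g ({1..t} - {b0}) {1..Suc e}"
      using finite_same_card_bij[of "{1..t} - {b0}" "{1..Suc e}"] by auto
    have "bij_betw (g(b0 := 0)) (insert b0 ({1..t} - {b0})) (insert 0 {1..Suc e})"
    proof -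
      have "bij_betw (g(b0 := 0)) ({1..t} - {b0}) {1..Suc e}"
        using g by (rule bij_betw_cong[THEN iffD1, rotated]) auto
      then show ?thesis using notIn_Un_bij_betw[of b0 "{1..t} - {b0}" "g(b0 := 0)" "{1..Suc e}"] by simp
    qed
    moreover have "insert b0 ({1..t} - {b0}) = {1..t}" "insert 0 {1..Suc e} = {..Suc e}" using b0t by auto
    ultimately show ?thesis using that[of "g(b0 := 0)"] by simp
  qed
  define C where "C X = {c S | S. S \<in> V \<and> S \<subseteq> pos_part X}" for X
  define p where "p X = Max (\<rho> ` C X)" for X
  let ?T = "two_sided r (r + e)"
  have CT: "C X \<subseteq> {1..t}" for X using c unfolding C_def t_def by blast
  have fin: "finite (\<rho> ` C X)" for X using CT finite_subset by blast
  have ne': "C X \<noteq> {}" if "X \<in> ?T" for X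
  proof -
    have "X \<in> two_sided (2 * (h * (k - 1) + 1)) n" using that unfolding r_def[symmetric] ne(1) .
    from stable_set_in_two_sided[OF this h k n] obtain S where "S \<subseteq> pos_part X" "s_stable (2 * h) n S" "card S = k" .
    then show ?thesis unfolding C_def V by blast
  qed
  have pin: "p X \<in> \<rho> ` C X" if "X \<in> ?T" for X
    unfolding p_def using fin ne'[OF that] by (intro Max_in) auto
  obtain X where X: "X \<in> ?T" "\<rho> ` A \<subseteq> p ` {Y \<in> ?T. Y \<subseteq> X}"
    "\<rho> ` B \<subseteq> (\<lambda>Y. p (uminus ` Y)) ` {Y \<in> ?T. Y \<subseteq> X}"
  proof (rule exists_split_chain[of r e p "\<rho> ` A" "\<rho> ` B"])
    show "r > 0" by (simp add: r_def)
    show "p X \<le> Suc e" if "X \<in> ?T" for X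
    proof -
      have "\<rho> ` C X \<subseteq> {..Suc e}" using CT[of X] \<rho>(1) by (auto simp: bij_betw_def)
      then show ?thesis using pin[OF that] by blast
    qed
    show "p X \<le> p Y" if "X \<in> ?T" "Y \<in> ?T" "X \<subseteq> Y" for X Y
    proof -
      have "C X \<subseteq> C Y" using pos_part_mono[OF that(3)] unfolding C_def by blast
      then show ?thesis unfolding p_def using fin ne'[OF that(1)] by (intro Max_mono) auto
    qed
    \<comment> \<open>Equal largest colours would come from two sets of the same colour on opposite
      sides of comparable vectors; such sets are disjoint, against properness.\<close>
    show "p X \<noteq> p (uminus ` Y)" if XY: "X \<in> ?T" "Y \<in> ?T" "X \<subseteq> Y \<or> Y \<subseteq> X" for X Y
    proof
      assume eq: "p X = p (uminus ` Y)"
      obtain x where x: "x \<in> C X" "p X = \<rho> x" using pin[OF XY(1)] by blast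
      obtain y where y: "y \<in> C (uminus ` Y)" "p X = \<rho> y"
        using pin[OF two_sided_uminus[OF XY(2)]] eq by auto
      have "x = y" using x y CT \<rho>(1) by (metis bij_betw_inv_into_left subsetD)
      then obtain S T where ST: "S \<in> V" "S \<subseteq> pos_part X" "T \<in> V" "T \<subseteq> pos_part (uminus ` Y)" "c S = c T"
        using x y unfolding C_def by auto
      have "X \<in> signed (r + e)" "Y \<in> signed (r + e)" using XY unfolding two_sided_def by auto
      then have "S \<inter> T = {}" using pos_part_disjoint[OF _ _ XY(3)] ST by blast
      then show False using proper ST by blast
    qed
    show "\<rho> ` A \<union> \<rho> ` B = {..Suc e}"
      using \<rho>(1) AB(1) unfolding t_def[symmetric] bij_betw_def by (metis image_Un)
    show "\<rho> ` A \<inter> \<rho> ` B = {}"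
    proof -
      have "inj_on \<rho> (A \<union> B)" using \<rho>(1) unfolding AB(1) t_def[symmetric] bij_betw_def by blast
      then show ?thesis using AB(2) by (metis Un_upper1 Un_upper2 image_empty inj_on_image_Int)
    qed
    show "\<rho> ` A \<noteq> {}" using AB(3) by simp
    show "0 \<in> \<rho> ` B" using b0 \<rho>(2) by (metis imageI)
  qed
  have inv: "\<exists>S\<in>V. S \<subseteq> pos_part Y \<and> c S = a" if aY: "a \<in> {1..t}" "Y \<in> ?T" "\<rho> a = p Y" for a Y
  proof -
    obtain x where x: "x \<in> C Y" "p Y = \<rho> x" using pin[OF aY(2)] by blast
    have "x = a" using x aY CT \<rho>(1) by (metis bij_betw_inv_into_left subsetD)
    then show ?thesis using x unfolding C_def by blast
  qed
  show ?thesis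
  proof
    have "X \<in> signed (r + e)" using X(1) unfolding two_sided_def by blast
    then show "pos_part X \<inter> pos_part (uminus ` X) = {}" using pos_part_disjoint[of X _ X] by blast
    fix a assume a: "a \<in> A"
    then obtain Y where Y: "Y \<in> ?T" "Y \<subseteq> X" "\<rho> a = p Y" using X(2) by blast
    have "a \<in> {1..t}" using a AB(1) unfolding t_def by blast
    then show "\<exists>S\<in>V. S \<subseteq> pos_part X \<and> c S = a"
      using inv[OF _ Y(1,3)] pos_part_mono[OF Y(2)] by blast
  next
    fix a assume a: "a \<in> B"
    then obtain Y where Y: "Y \<in> ?T" "Y \<subseteq> X" "\<rho> a = p (uminus ` Y)" using X(3) by blast
    have "a \<in> {1..t}" using a AB(1) unfolding t_def by blast
    then have "\<exists>S\<in>V. S \<subseteq> pos_part (uminus ` Y) \<and> c S = a"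
      using inv[OF _ two_sided_uminus[OF Y(1)] Y(3)] by blast
    moreover have "pos_part (uminus ` Y) \<subseteq> pos_part (uminus ` X)" using Y(2) by (intro pos_part_mono image_mono)
    ultimately show "\<exists>S\<in>V. S \<subseteq> pos_part (uminus ` X) \<and> c S = a" by blast
  qed
qed

theorem theorem8:
  fixes n k s l m :: nat and c :: "nat set \<Rightarrow> nat" and A B :: "nat set"
  assumes "n > 0" and "k > 0" and "s > 0"
    and "even s"
    and "n \<ge> (s + 2) * k - 2"
    and "proper_coloring (with_proj (stable_kneser_graph s n k)) {1..n - s * (k - 1)} c"
    and "A \<union> B = {1..n - s * (k - 1)}" and "A \<inter> B = {}"
    and "l = card A" and "m = card B"
  shows "\<exists>L M. L \<inter> M = {} \<and> card L = l \<and> card M = m \<and>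
    subgraph (with_proj (complete_bipartite_graph L M)) (with_proj (stable_kneser_graph s n k)) \<and>
    bij_betw c L A \<and> bij_betw c M B"
proof -
  obtain h where s: "s = 2 * h" using \<open>even s\<close> by blast
  have h: "h > 0" using s \<open>s > 0\<close> by simp
  define V where "V = {S. s_stable (2 * h) n S \<and> card S = k}"
  define t where "t = n - 2 * h * (k - 1)"
  have n: "n \<ge> (2 * h + 2) * k - 2" using assms(5) s by simp
  have verts: "pverts (stable_kneser_graph s n k) = V"
    by (simp add: stable_kneser_graph_def V_def s)
  have arcs: "parcs (stable_kneser_graph s n k) = {(S, T). S \<in> V \<and> T \<in> V \<and> S \<inter> T = {}}"
    by (auto simp: stable_kneser_graph_def V_def s)
  have tc: "n - s * (k - 1) = t" by (simp add: t_def s)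
  have c: "c S \<in> {1..t}" if "S \<in> V" for S
    using assms(6) that unfolding proper_coloring_def tc by (auto simp: verts)
  have proper: "c S \<noteq> c T" if "S \<in> V" "T \<in> V" "S \<inter> T = {}" for S T
    using assms(6) that unfolding proper_coloring_def arcs_ends_def arc_to_ends_def by (auto simp: arcs)
  have AB: "A \<union> B = {1..t}" using assms(7) unfolding tc .
  have split: "\<exists>P Q. P \<inter> Q = {} \<and> (\<forall>a\<in>A'. \<exists>S\<in>V. S \<subseteq> P \<and> c S = a) \<and> (\<forall>b\<in>B'. \<exists>S\<in>V. S \<subseteq> Q \<and> c S = b)"
    if "A' \<union> B' = {1..t}" "A' \<inter> B' = {}" "A' \<noteq> {}" "B' \<noteq> {}" for A' B'
  proof (rule colorful_disjoint_sets[of h k n V c A' B'])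
    fix P Q
    assume PQ: "P \<inter> Q = {}" "\<And>a. a \<in> A' \<Longrightarrow> \<exists>S\<in>V. S \<subseteq> P \<and> c S = a" "\<And>b. b \<in> B' \<Longrightarrow> \<exists>S\<in>V. S \<subseteq> Q \<and> c S = b"
    show ?thesis by (intro exI[of _ P] exI[of _ Q] conjI ballI PQ)
  next
    show "c S \<in> {1..n - 2 * h * (k - 1)}" if "S \<in> V" for S using c[OF that] unfolding t_def .
    show "A' \<union> B' = {1..n - 2 * h * (k - 1)}" using that(1) unfolding t_def .
  qed (fact h \<open>k > 0\<close> n V_def proper that)+
  obtain k' where k': "k = Suc k'" using \<open>k > 0\<close> by (cases k) auto
  have "n \<ge> 2 * h * k' + 2 * h + 2 * k'" using n unfolding k' by (simp add: algebra_simps)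
  then have t: "t \<ge> 2" using h by (simp add: t_def k')
  \<comment> \<open>When \<open>A\<close> or \<open>B\<close> is empty, the claim reduces to the
    occurrence of every colour. This follows from the split into \<open>{1}\<close> and
    \<open>{2..t}\<close>, both nonempty as \<open>t \<ge> 2\<close>.\<close>
  have all: "\<exists>S\<in>V. c S = a" if "a \<in> {1..t}" for a
  proof -
    have u: "{1} \<union> {2..t} = {1..t}" "{1} \<inter> {2..t} = {}" "{1::nat} \<noteq> {}" "{2..t} \<noteq> {}" using t by auto
    show ?thesis using split[OF u] that unfolding u(1)[symmetric] by blast
  qed
  obtain P Q where PQ: "P \<inter> Q = {}" "\<forall>a\<in>A. \<exists>S\<in>V. S \<subseteq> P \<and> c S = a" "\<forall>b\<in>B. \<exists>S\<in>V. S \<subseteq> Q \<and> c S = b"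
  proof -
    consider "A = {}" | "B = {}" | "A \<noteq> {}" "B \<noteq> {}" by blast
    then show ?thesis
    proof cases
      case 1
      then show ?thesis using that[of "{}" UNIV] all AB by auto
    next
      case 2
      then show ?thesis using that[of UNIV "{}"] all AB by auto
    next
      case 3
      then show ?thesis using split[OF AB assms(8)] that by blast
    qed
  qed
  obtain F where F: "\<And>a. a \<in> A \<Longrightarrow> F a \<in> V \<and> F a \<subseteq> P \<and> c (F a) = a" using PQ(2) by metis
  obtain G where G: "\<And>b. b \<in> B \<Longrightarrow> G b \<in> V \<and> G b \<subseteq> Q \<and> c (G b) = b" using PQ(3) by metis
  have bF: "bij_betw c (F ` A) A" by (rule bij_betw_byWitness[of _ F]) (use F in auto)
  have bG: "bij_betw c (G ` B) B" by (rule bij_betw_byWitness[of _ G]) (use G in auto)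
  have "subgraph (with_proj (complete_bipartite_graph (F ` A) (G ` B))) (with_proj (stable_kneser_graph s n k))"
    unfolding subgraph_def
  proof (intro conjI)
    let ?H = "complete_bipartite_graph (F ` A) (G ` B)"
    show "verts (with_proj ?H) \<subseteq> verts (with_proj (stable_kneser_graph s n k))"
      using F G by (auto simp: verts complete_bipartite_graph_def)
    have "S \<inter> T = {}" if "S \<in> F ` A" "T \<in> G ` B" for S T
      using that F G PQ(1) by blast
    then show "arcs (with_proj ?H) \<subseteq> arcs (with_proj (stable_kneser_graph s n k))"
      using F G by (auto simp: arcs complete_bipartite_graph_def)
    interpret pair_graph "stable_kneser_graph s n k" by (rule pair_graph_stable_kneser_graph)
    show "wf_digraph (with_proj (stable_kneser_graph s n k))" by unfold_locales
    show "wf_digraph (with_proj ?H)" by unfold_locales (auto simp: complete_bipartite_graph_def)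
    show "compatible (with_proj (stable_kneser_graph s n k)) (with_proj ?H)"
      by (simp add: compatible_def)
  qed
  moreover have "F ` A \<inter> G ` B = {}"
  proof -
    have "c S \<in> A" if "S \<in> F ` A" for S using F that by auto
    moreover have "c S \<in> B" if "S \<in> G ` B" for S using G that by auto
    ultimately show ?thesis using \<open>A \<inter> B = {}\<close> by blast
  qed
  ultimately show ?thesis
    using bF bG assms(9,10) bij_betw_same_card by blast
qed

end
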